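(* Let $G_w$ be a weighted bicyclic graph with no pendant vertices. Then the rank of $A(G_w)$ equals $4$ if and only if $G_w$ is (isomorphic as a weighted graph to) one of the following: (1) $\infty(4,1,4)_w$ with $a_1a_3=a_2a_4$ and $b_1b_3=b_2b_4$; (2) $\theta(1,1,1)_w$ with $a_2b_1\ne a_1b_2$ or $a_2c_1\ne a_1c_2$; (3) $\theta(1,0,1)_w$ with $a_2c_1\ne a_1c_2$; (4) $\theta(1,0,2)_w$ with $b_1c_2=c_1c_3$; (5) $\theta(2,0,2)_w$ with $a_2b_1c_2-a_1a_3c_2-a_2c_1c_3=0$.
   Context: A weighted graph $G_w$ is a simple graph with a positive weight on each edge; its adjacency matrix $A(G_w)$ has entry $w(xy)$ if $xy$ is an edge and $0$ otherwise. A bicyclic graph is a connected simple graph with $|E|=|V|+1$. $\infty(4,1,4)_w$ consists of two $4$-cycles $v x_1x_2x_3v$ and $v y_1y_2y_3v$ sharing only the vertex $v$, with weights $w(vx_1)=a_1,w(x_1x_2)=a_2,w(x_2x_3)=a_3,w(x_3v)=a_4$ and $w(vy_1)=b_1,w(y_1y_2)=b_2,w(y_2y_3)=b_3,w(y_3v)=b_4$. For integers $p,l,q\ge0$ with at most one equal to $0$, $\theta(p,l,q)_w$ consists of two vertices $u,v$ joined by three internally disjoint paths $ux_1\cdots x_pv$, $uy_1\cdots y_lv$, $uz_1\cdots z_qv$ (a path with no internal vertex being the edge $uv$), with edge weights read from $u$ to $v$ equal to $a_1,\dots,a_{p+1}$, $b_1,\dots,b_{l+1}$ and $c_1,\dots,c_{q+1}$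 respectively. *)

theory Defs
  imports "Jordan_Normal_Form.DL_Rank"
begin

text \<open>Only the values of \<open>weight\<close> on edges are meaningful.\<close>

record 'a wgraph =
  verts :: "'a set"
  edges :: "'a set set"
  weight :: "'a set \<Rightarrow> real"

definition weighted_graph :: "'a wgraph \<Rightarrow> bool" where
  "weighted_graph G \<longleftrightarrow>
     finite (verts G) \<and>
     (\<forall>e \<in> edges G. e \<subseteq> verts G \<and> card e = 2) \<and>
     (\<forall>e \<in> edges G. weight G e > 0)"

definition connected_graph :: "'a wgraph \<Rightarrow> bool" where
  "connected_graph G \<longleftrightarrow>
     verts G \<noteq> {} \<and>
     (\<forall>x \<in> verts G. \<forall>y \<in> verts G. (x, y) \<in> {(s, t). {s, t} \<in> edges G}\<^sup>*)"

definition bicyclic :: "'a wgraph \<Rightarrow> bool" where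
  "bicyclic G \<longleftrightarrow> connected_graph G \<and> card (edges G) = card (verts G) + 1"

definition vertex_degree :: "'a wgraph \<Rightarrow> 'a \<Rightarrow> nat" where
  "vertex_degree G x = card {e \<in> edges G. x \<in> e}"

definition pendant :: "'a wgraph \<Rightarrow> 'a \<Rightarrow> bool" where
  "pendant G x \<longleftrightarrow> x \<in> verts G \<and> vertex_degree G x = 1"

text \<open>The rows and columns are indexed by an enumeration \<open>vs\<close> of the vertices.\<close>

definition adjacency_matrix :: "'a wgraph \<Rightarrow> 'a list \<Rightarrow> real mat" where
  "adjacency_matrix G vs =
     mat (length vs) (length vs)
       (\<lambda>(i, j). if {vs ! i, vs ! j} \<in> edges G then weight G {vs ! i, vs ! j} else 0)"

definition matrix_rank :: "real mat \<Rightarrow> nat" where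
  "matrix_rank A = vec_space.rank (dim_row A) A"

definition wgraph_iso :: "'a wgraph \<Rightarrow> 'b wgraph \<Rightarrow> bool" where
  "wgraph_iso G H \<longleftrightarrow>
     (\<exists>f. bij_betw f (verts G) (verts H) \<and>
          (\<forall>x \<in> verts G. \<forall>y \<in> verts G.
             ({x, y} \<in> edges G \<longleftrightarrow> {f x, f y} \<in> edges H) \<and>
             ({x, y} \<in> edges G \<longrightarrow> weight G {x, y} = weight H {f x, f y})))"

text \<open>The list of weighted edges of a walk given by its vertex list and the list of its weights.\<close>

definition weighted_walk :: "'a list \<Rightarrow> real list \<Rightarrow> ('a set \<times> real) list" where
  "weighted_walk xs ws = zip (map2 (\<lambda>x y. {x, y}) xs (tl xs)) ws"

text \<open>The graph with the listed edges, which must be pairwise distinct.\<close>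

definition wgraph_of :: "('a set \<times> real) list \<Rightarrow> 'a wgraph" where
  "wgraph_of es =
     \<lparr>verts = \<Union> (fst ` set es), edges = fst ` set es, weight = (\<lambda>e. the (map_of es e))\<rparr>"

datatype bvertex = Vu | Vv | Vx nat | Vy nat | Vz nat

text \<open>Weight sequences are read from index 1 on, so that \<open>a 1, a 2, \<dots>\<close> are the
  weights $a_1, a_2, \dots$.\<close>

definition infinity414 :: "(nat \<Rightarrow> real) \<Rightarrow> (nat \<Rightarrow> real) \<Rightarrow> bvertex wgraph" where
  "infinity414 a b =
     wgraph_of
       (weighted_walk [Vv, Vx 1, Vx 2, Vx 3, Vv] [a 1, a 2, a 3, a 4] @
        weighted_walk [Vv, Vy 1, Vy 2, Vy 3, Vv] [b 1, b 2, b 3, b 4])"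

text \<open>At most one of \<open>p, l, q\<close> may be 0; otherwise the edge \<open>{Vu, Vv}\<close> would be listed twice.\<close>

definition theta ::
  "nat \<Rightarrow> nat \<Rightarrow> nat \<Rightarrow> (nat \<Rightarrow> real) \<Rightarrow> (nat \<Rightarrow> real) \<Rightarrow> (nat \<Rightarrow> real) \<Rightarrow> bvertex wgraph" where
  "theta p l q a b c =
     wgraph_of
       (weighted_walk (Vu # map Vx [1..<p+1] @ [Vv]) (map a [1..<p+2]) @
        weighted_walk (Vu # map Vy [1..<l+1] @ [Vv]) (map b [1..<l+2]) @
        weighted_walk (Vu # map Vz [1..<q+1] @ [Vv]) (map c [1..<q+2]))"

end

theory Submission
  imports Defs
begin

text \<open>Rank 4 means that any five columns of the adjacency matrix are linearly dependent, so any five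
  vertices carry a nonzero null vector. Positivity of the weights turns the equations at the other
  vertices into sign conditions, and these already force the vector to vanish as soon as the graph
  has an induced pentagon, a triangle or 4-cycle attached in the wrong way, or a long path. A
  bicyclic graph without pendant vertices has either one vertex of degree 4 or two of degree 3, all
  other degrees being 2, and following the paths that leave these vertices under the above
  restrictions leaves only the five listed shapes. For these the rank is found by exhibiting an
  explicit column basis.\<close>

section \<open>Rank and null vectors\<close>

text \<open>The classification forgets the weights and keeps only the neighbourhood function.
  Nothing is lost there, because the excluded configurations have rank above 4 for every choice of
  positive weights; an odd cycle, for instance, has determinant twice the product of its weights. A
  4-cycle is different: it is singular or not depending on its weights, which is why 4-cycles
  survive in the list and carry conditions. These conditions come from rank computations stated as
  equivalences, so the same lemmas serve both directions of the theorem. Their form shows on which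
  side the rank can go wrong: \<open>theta 1 1 1\<close> and \<open>theta 1 0 1\<close> have rank at
  most 4 and drop to 2 and 3 when their inequalities fail, whereas the other three shapes have rank
  above 4 unless their equations hold.\<close>

lemma (in vec_space) lincomb_cols_index:
  assumes "A \<in> carrier_mat n m" "J \<subseteq> {..<m}" "inj_on (col A) J" "i < n"
  shows "lincomb a (col A ` J) $ i = (\<Sum>j\<in>J. A $$ (i, j) * a (col A j))"
proof -
  have "col A ` J \<subseteq> carrier_vec n" using assms by auto
  then have "lincomb a (col A ` J) $ i = (\<Sum>j\<in>J. a (col A j) * col A j $ i)"
    using assms by (simp add: lincomb_index sum.reindex)
  also have "\<dots> = (\<Sum>j\<in>J. A $$ (i, j) * a (col A j))"
    using assms by (intro sum.cong) auto
  finally show ?thesis .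
qed

text \<open>Independence is a property of a set of vectors, so two equal columns merge into one
  element although the family of columns is dependent. The relation used here is the difference of
  two unit vectors.\<close>

lemma equal_cols_null_vector:
  assumes A: "A \<in> carrier_mat n m" and J: "J \<subseteq> {..<m}"
    and jk: "j \<in> J" "k \<in> J" "j \<noteq> k" "col A j = col A k"
  shows "\<exists>x::nat \<Rightarrow> real. x j \<noteq> 0 \<and> (\<forall>i<n. (\<Sum>l\<in>J. A $$ (i, l) * x l) = 0)"
proof -
  have fin: "finite J" using J finite_subset by blast
  have jkm: "j < m" "k < m" using jk J by auto
  define x :: "nat \<Rightarrow> real" where "x = (\<lambda>l. if l = j then 1 else if l = k then -1 else 0)"
  have "(\<Sum>l\<in>J. A $$ (i, l) * x l) = 0" if "i < n" for i
  proof -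
    have "(\<Sum>l\<in>J. A $$ (i, l) * x l) = (\<Sum>l\<in>{j, k}. A $$ (i, l) * x l)"
      using jk fin by (intro sum.mono_neutral_right) (auto simp: x_def)
    also have "\<dots> = A $$ (i, j) - A $$ (i, k)"
      using jk by (simp add: x_def)
    also have "\<dots> = col A j $ i - col A k $ i"
      using jkm that A by simp
    also have "\<dots> = 0" using jk(4) by simp
    finally show ?thesis .
  qed
  moreover have "x j \<noteq> 0" by (simp add: x_def)
  ultimately show ?thesis by blast
qed

text \<open>Either two of the columns in \<open>J\<close> coincide, or they form a set with more
  elements than the rank, hence a dependent one. Coefficients are returned by column index, so that
  one vector on \<open>J\<close> annihilates every row.\<close>

lemma rank_less_imp_null_vector:
  assumes A: "A \<in> carrier_mat n m" and J: "J \<subseteq> {..<m}" and r: "matrix_rank A < card J"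
  shows "\<exists>x. (\<exists>j\<in>J. x j \<noteq> 0) \<and> (\<forall>i<n. (\<Sum>j\<in>J. A $$ (i, j) * x j) = 0)"
proof (cases "inj_on (col A) J")
  case False
  then obtain j k where jk: "j \<in> J" "k \<in> J" "j \<noteq> k" "col A j = col A k"
    by (auto simp: inj_on_def)
  from equal_cols_null_vector[OF A J this] obtain x :: "nat \<Rightarrow> real"
    where "x j \<noteq> 0" "\<forall>i<n. (\<Sum>l\<in>J. A $$ (i, l) * x l) = 0" by blast
  then show ?thesis using jk(1) by blast
next
  case True
  interpret vec_space "TYPE(real)" n .
  have fin: "finite (col A ` J)" using J finite_subset by blast
  have sub: "col A ` J \<subseteq> carrier_vec n" using A J by auto
  have "col A ` J \<subseteq> set (cols A)"
    using A J by (auto simp: cols_def)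
  then have "lin_dep (col A ` J)"
    using rank_ge_card_indpt[OF A, of "col A ` J"] r
    unfolding matrix_rank_def carrier_matD(1)[OF A] card_image[OF True] by fastforce
  then obtain a v where a: "lincomb a (col A ` J) = 0\<^sub>v n" "v \<in> col A ` J" "a v \<noteq> 0"
    using finite_lin_dep[OF fin] sub by auto
  have "(\<Sum>j\<in>J. A $$ (i, j) * a (col A j)) = 0" if "i < n" for i
    using lincomb_cols_index[OF A J True that, of a] a(1) that by simp
  moreover have "\<exists>j\<in>J. a (col A j) \<noteq> 0" using a(2,3) by blast
  ultimately show ?thesis by (intro exI[of _ "\<lambda>j. a (col A j)"]) blast
qed

text \<open>Independent columns that generate the remaining ones form a maximal independent set of
  columns, and such a set has as many elements as the rank. Both hypotheses are entrywise, so that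
  for a concrete graph they become small linear systems.\<close>

lemma rank_eq_card_if_column_basis:
  assumes A: "A \<in> carrier_mat n m" and J: "J \<subseteq> {..<m}"
    and indep: "\<And>x j. \<forall>i<n. (\<Sum>j\<in>J. A $$ (i, j) * x j) = 0 \<Longrightarrow> j \<in> J \<Longrightarrow> x j = 0"
    and span: "\<And>k. k < m \<Longrightarrow> k \<notin> J \<Longrightarrow> \<exists>x. \<forall>i<n. A $$ (i, k) = (\<Sum>j\<in>J. A $$ (i, j) * x j)"
  shows "matrix_rank A = card J"
proof -
  interpret vec_space "TYPE(real)" n .
  have finJ: "finite J" using J finite_subset by blast
  have inj: "inj_on (col A) J"
  proof (rule inj_onI, rule ccontr)
    fix j k assume jk: "j \<in> J" "k \<in> J" "col A j = col A k" "j \<noteq> k"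
    from equal_cols_null_vector[OF A J jk(1,2,4,3)] obtain x :: "nat \<Rightarrow> real"
      where "x j \<noteq> 0" "\<forall>i<n. (\<Sum>l\<in>J. A $$ (i, l) * x l) = 0" by blast
    then show False using indep[of x j] jk(1) by blast
  qed
  let ?U = "col A ` J"
  have fin: "finite ?U" using finJ by blast
  have sub: "?U \<subseteq> carrier_vec n" using A J by auto
  have subc: "?U \<subseteq> set (cols A)" using A J by (auto simp: cols_def)
  have li: "lin_indpt ?U"
  proof
    assume "lin_dep ?U"
    then obtain a v where a: "lincomb a ?U = 0\<^sub>v n" "v \<in> ?U" "a v \<noteq> 0"
      using finite_lin_dep[OF fin] sub by auto
    have "(\<Sum>j\<in>J. A $$ (i, j) * a (col A j)) = 0" if "i < n" for i
      using lincomb_cols_index[OF A J inj that, of a] a(1) that by simp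
    then have "a (col A j) = 0" if "j \<in> J" for j
      using indep[of "\<lambda>j. a (col A j)" j] that by blast
    then show False using a(2,3) by blast
  qed
  have "maximal ?U (\<lambda>T. T \<subseteq> set (cols A) \<and> lin_indpt T)"
    unfolding maximal_def
  proof (intro conjI allI impI subc li)
    fix T assume T: "?U \<subseteq> T \<and> T \<subseteq> set (cols A) \<and> lin_indpt T"
    show "T = ?U"
    proof (rule ccontr)
      assume "T \<noteq> ?U"
      then obtain c where c: "c \<in> T" "c \<notin> ?U" using T by blast
      then obtain k where k: "k < m" "c = col A k"
        using T A by (auto simp: cols_def)
      then have "k \<notin> J" using c by auto
      from span[OF k(1) this] obtain x
        where x: "\<And>i. i < n \<Longrightarrow> A $$ (i, k) = (\<Sum>j\<in>J. A $$ (i, j) * x j)" by blast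
      \<comment> \<open>The coefficients move from column indices to vectors, which is well defined
        because \<open>col A\<close> is injective on \<open>J\<close>.\<close>
      define a where "a v = x (the_inv_into J (col A) v)" for v
      have ax: "a (col A j) = x j" if "j \<in> J" for j
        using that inj by (simp add: a_def the_inv_into_f_f)
      have "c = lincomb a ?U"
      proof
        show d: "dim_vec c = dim_vec (lincomb a ?U)"
          using lincomb_dim[OF fin sub, of a] k A by simp
        fix i assume "i < dim_vec (lincomb a ?U)"
        then have i: "i < n" using d k A by simp
        have "lincomb a ?U $ i = (\<Sum>j\<in>J. A $$ (i, j) * a (col A j))"
          by (rule lincomb_cols_index[OF A J inj i])
        also have "\<dots> = A $$ (i, k)" using x[OF i] ax by simp
        finally show "c $ i = lincomb a ?U $ i" using k i A by simp
      qed
      then have "c \<in> LinearCombinations.module.span class_ring V ?U"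
        using finite_span[OF fin sub] by auto
      moreover have "c \<in> carrier_vec n" using k A by auto
      ultimately have "lin_dep (insert c ?U)"
        using lin_dep_iff_in_span[OF sub li _ c(2)] by simp
      moreover have "lin_indpt (insert c ?U)"
        using subset_li_is_li[of T "insert c ?U"] T c by auto
      ultimately show False by blast
    qed
  qed
  from rank_card_indpt[OF A this] show ?thesis
    using A inj by (simp add: matrix_rank_def card_image)
qed

section \<open>Adjacency matrices indexed by vertices\<close>

definition adj :: "'a wgraph \<Rightarrow> 'a \<Rightarrow> 'a \<Rightarrow> real" where
  "adj G x y = (if {x, y} \<in> edges G then weight G {x, y} else 0)"

lemma adjacency_matrix_carrier:
  "adjacency_matrix G vs \<in> carrier_mat (length vs) (length vs)"
  by (simp add: adjacency_matrix_def)

lemma adjacency_matrix_index: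
  "i < length vs \<Longrightarrow> j < length vs \<Longrightarrow> adjacency_matrix G vs $$ (i, j) = adj G (vs ! i) (vs ! j)"
  by (simp add: adjacency_matrix_def adj_def)

lemma bij_betw_nth_subset:
  assumes "distinct vs" "K \<subseteq> set vs"
  shows "bij_betw ((!) vs) {i. i < length vs \<and> vs ! i \<in> K} K"
  using assms by (auto simp: bij_betw_def inj_on_def nth_eq_iff_index_eq in_set_conv_nth subset_iff image_iff)

text \<open>Indexing into \<open>vs\<close> is a bijection from the positions in \<open>J\<close> to
  the vertices in \<open>K\<close>. Transporting along it confines the enumeration \<open>vs\<close>
  to the rank itself; all equations are indexed by vertices.\<close>

lemma adjacency_rank_less_imp_null_vector:
  assumes vs: "distinct vs" "set vs = verts G" and K: "K \<subseteq> verts G"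
    and r: "matrix_rank (adjacency_matrix G vs) < card K"
  shows "\<exists>x. (\<exists>k\<in>K. x k \<noteq> 0) \<and> (\<forall>z\<in>verts G. (\<Sum>k\<in>K. adj G z k * x k) = 0)"
proof -
  define J where "J = {i. i < length vs \<and> vs ! i \<in> K}"
  have bij: "bij_betw ((!) vs) J K"
    using bij_betw_nth_subset[of vs K] vs K by (simp add: J_def)
  have J: "J \<subseteq> {..<length vs}" by (auto simp: J_def)
  have "matrix_rank (adjacency_matrix G vs) < card J" using r bij_betw_same_card[OF bij] by simp
  from rank_less_imp_null_vector[OF adjacency_matrix_carrier J this]
  obtain y where y: "\<exists>j\<in>J. y j \<noteq> 0"
      "\<forall>i<length vs. (\<Sum>j\<in>J. adjacency_matrix G vs $$ (i, j) * y j) = 0"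
    by (elim exE conjE)
  define x where "x k = y (the_inv_into J ((!) vs) k)" for k
  have xy: "x (vs ! j) = y j" if "j \<in> J" for j
    using that bij by (simp add: x_def bij_betw_def the_inv_into_f_f)
  have "(\<Sum>k\<in>K. adj G (vs ! i) k * x k) = 0" if i: "i < length vs" for i
  proof -
    have "(\<Sum>k\<in>K. adj G (vs ! i) k * x k) = (\<Sum>j\<in>J. adj G (vs ! i) (vs ! j) * x (vs ! j))"
      using sum.reindex_bij_betw[OF bij, of "\<lambda>k. adj G (vs ! i) k * x k"] by simp
    also have "\<dots> = (\<Sum>j\<in>J. adjacency_matrix G vs $$ (i, j) * y j)"
      using i J by (intro sum.cong) (auto simp: xy adjacency_matrix_index)
    finally show ?thesis using y i by simp
  qed
  then have null: "\<forall>z\<in>verts G. (\<Sum>k\<in>K. adj G z k * x k) = 0"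
    unfolding vs(2)[symmetric] all_set_conv_all_nth by blast
  obtain j where j: "j \<in> J" "y j \<noteq> 0" using y(1) by blast
  have nz: "\<exists>k\<in>K. x k \<noteq> 0"
  proof
    show "vs ! j \<in> K" using j(1) by (simp add: J_def)
    show "x (vs ! j) \<noteq> 0" using j by (simp add: xy)
  qed
  show ?thesis by (rule exI[of _ x], rule conjI, rule nz, rule null)
qed

lemma adjacency_rank_eq_card:
  assumes vs: "distinct vs" "set vs = verts G" and K: "K \<subseteq> verts G"
    and indep: "\<And>x k. \<forall>z\<in>verts G. (\<Sum>k\<in>K. adj G z k * x k) = 0 \<Longrightarrow> k \<in> K \<Longrightarrow> x k = 0"
    and span: "\<And>v. v \<in> verts G \<Longrightarrow> v \<notin> K \<Longrightarrow> \<exists>x. \<forall>z\<in>verts G. adj G z v = (\<Sum>k\<in>K. adj G z k * x k)"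
  shows "matrix_rank (adjacency_matrix G vs) = card K"
proof -
  define J where "J = {i. i < length vs \<and> vs ! i \<in> K}"
  have bij: "bij_betw ((!) vs) J K"
    using bij_betw_nth_subset[of vs K] vs K by (simp add: J_def)
  have J: "J \<subseteq> {..<length vs}" by (auto simp: J_def)
  have sums: "(\<Sum>j\<in>J. adjacency_matrix G vs $$ (i, j) * x (vs ! j)) = (\<Sum>k\<in>K. adj G (vs ! i) k * x k)"
    if i: "i < length vs" for i x
  proof -
    have "(\<Sum>j\<in>J. adjacency_matrix G vs $$ (i, j) * x (vs ! j)) = (\<Sum>j\<in>J. adj G (vs ! i) (vs ! j) * x (vs ! j))"
      using i J by (intro sum.cong) (auto simp: adjacency_matrix_index)
    then show ?thesis
      using sum.reindex_bij_betw[OF bij, of "\<lambda>k. adj G (vs ! i) k * x k"] by simp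
  qed
  have "matrix_rank (adjacency_matrix G vs) = card J"
  proof (rule rank_eq_card_if_column_basis[OF adjacency_matrix_carrier J])
    fix y j assume y: "\<forall>i<length vs. (\<Sum>j\<in>J. adjacency_matrix G vs $$ (i, j) * y j) = 0" and j: "j \<in> J"
    define x where "x k = y (the_inv_into J ((!) vs) k)" for k
    have xy: "x (vs ! j) = y j" if "j \<in> J" for j
      using that bij by (simp add: x_def bij_betw_def the_inv_into_f_f)
    have "(\<Sum>k\<in>K. adj G (vs ! i) k * x k) = 0" if i: "i < length vs" for i
    proof -
      have "(\<Sum>k\<in>K. adj G (vs ! i) k * x k) = (\<Sum>j\<in>J. adjacency_matrix G vs $$ (i, j) * x (vs ! j))"
        using sums[OF i] by simp
      also have "\<dots> = (\<Sum>j\<in>J. adjacency_matrix G vs $$ (i, j) * y j)"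
        by (intro sum.cong) (auto simp: xy)
      finally show ?thesis using y i by simp
    qed
    then have "\<forall>z\<in>verts G. (\<Sum>k\<in>K. adj G z k * x k) = 0"
      unfolding vs(2)[symmetric] all_set_conv_all_nth by blast
    moreover have "vs ! j \<in> K" using j by (simp add: J_def)
    ultimately have "x (vs ! j) = 0" by (rule indep)
    then show "y j = 0" using xy[OF j] by simp
  next
    fix l assume l: "l < length vs" "l \<notin> J"
    have "vs ! l \<in> verts G" using l(1) vs(2) nth_mem by metis
    moreover have "vs ! l \<notin> K" using l by (simp add: J_def)
    ultimately have vl: "vs ! l \<in> verts G" "vs ! l \<notin> K" .
    from span[OF vl] obtain x where x: "\<forall>z\<in>verts G. adj G z (vs ! l) = (\<Sum>k\<in>K. adj G z k * x k)"
      by blast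
    have *: "adjacency_matrix G vs $$ (i, l) = (\<Sum>j\<in>J. adjacency_matrix G vs $$ (i, j) * x (vs ! j))"
      if i: "i < length vs" for i
    proof -
      have "vs ! i \<in> verts G" using i vs(2) nth_mem by metis
      then show ?thesis unfolding sums[OF i] adjacency_matrix_index[OF i l(1)] using x by blast
    qed
    show "\<exists>y. \<forall>i<length vs. adjacency_matrix G vs $$ (i, l)
        = (\<Sum>j\<in>J. adjacency_matrix G vs $$ (i, j) * y j)"
      by (rule exI[of _ "\<lambda>j. x (vs ! j)"], intro allI impI, rule *)
  qed
  then show ?thesis using bij_betw_same_card[OF bij] by simp
qed

section \<open>The five shapes\<close>

text \<open>The inverse map is the convenient one: a map from a fixed shape into \<open>G\<close>
  names the vertices of \<open>G\<close>, and the edges become images of listed edges instead of a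
  condition on all pairs. The hypotheses make every edge a pair of vertices, so that testing pairs
  reaches all edges.\<close>

lemma wgraph_iso_iff:
  assumes G: "\<And>e. e \<in> edges G \<Longrightarrow> \<exists>s\<in>verts G. \<exists>t\<in>verts G. e = {s, t}"
    and H: "\<And>e. e \<in> edges H \<Longrightarrow> \<exists>s\<in>verts H. \<exists>t\<in>verts H. e = {s, t}"
  shows "wgraph_iso G H \<longleftrightarrow> (\<exists>g. bij_betw g (verts H) (verts G) \<and>
    edges G = (`) g ` edges H \<and> (\<forall>e\<in>edges H. weight G (g ` e) = weight H e))"
    (is "_ \<longleftrightarrow> ?R")
proof
  assume "wgraph_iso G H"
  then obtain f where f: "bij_betw f (verts G) (verts H)"
    and all: "\<forall>x\<in>verts G. \<forall>y\<in>verts G. ({x, y} \<in> edges G \<longleftrightarrow> {f x, f y} \<in> edges H) \<and>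
      ({x, y} \<in> edges G \<longrightarrow> weight G {x, y} = weight H {f x, f y})"
    unfolding wgraph_iso_def by (elim exE conjE)
  have e: "\<And>x y. x \<in> verts G \<Longrightarrow> y \<in> verts G \<Longrightarrow> {x, y} \<in> edges G \<longleftrightarrow> {f x, f y} \<in> edges H"
    and w: "\<And>x y. x \<in> verts G \<Longrightarrow> y \<in> verts G \<Longrightarrow> {x, y} \<in> edges G \<Longrightarrow> weight G {x, y} = weight H {f x, f y}"
    using all by blast+
  define g where "g = the_inv_into (verts G) f"
  have g: "bij_betw g (verts H) (verts G)" unfolding g_def using f by (rule bij_betw_the_inv_into)
  have fg: "f (g t) = t" if "t \<in> verts H" for t
    unfolding g_def using f_the_inv_into_f_bij_betw[OF f] that by blast
  have gf: "g (f s) = s" if "s \<in> verts G" for s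
    unfolding g_def using the_inv_into_f_f[OF bij_betw_imp_inj_on[OF f] that] .
  have gm: "g t \<in> verts G" if "t \<in> verts H" for t using g that by (rule bij_betw_apply)
  have sub: "g ` d \<in> edges G \<and> weight G (g ` d) = weight H d" if d: "d \<in> edges H" for d
  proof -
    obtain s t where st: "s \<in> verts H" "t \<in> verts H" "d = {s, t}" using H[OF d] by blast
    have "g ` d = {g s, g t}" "{f (g s), f (g t)} = d" using st fg by simp_all
    then show ?thesis
      using e[OF gm[OF st(1)] gm[OF st(2)]] w[OF gm[OF st(1)] gm[OF st(2)]] d by simp
  qed
  have sup: "d \<in> (`) g ` edges H" if d: "d \<in> edges G" for d
  proof -
    obtain s t where st: "s \<in> verts G" "t \<in> verts G" "d = {s, t}" using G[OF d] by blast
    then have "{f s, f t} \<in> edges H" "d = g ` {f s, f t}"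
      using e[OF st(1,2)] d gf[OF st(1)] gf[OF st(2)] by simp_all
    then show ?thesis by (metis imageI)
  qed
  have "(`) g ` edges H \<subseteq> edges G" using sub by (intro image_subsetI) blast
  moreover have "edges G \<subseteq> (`) g ` edges H" using sup by (rule subsetI)
  ultimately have "edges G = (`) g ` edges H" by (intro subset_antisym)
  moreover have "\<forall>d\<in>edges H. weight G (g ` d) = weight H d" using sub by blast
  ultimately have *: "bij_betw g (verts H) (verts G) \<and> edges G = (`) g ` edges H \<and>
    (\<forall>d\<in>edges H. weight G (g ` d) = weight H d)" by (intro conjI g)
  show ?R by (rule exI[of _ g]) (rule *)
next
  assume ?R
  then obtain g where g: "bij_betw g (verts H) (verts G)" and e: "edges G = (`) g ` edges H"
    and w': "\<forall>e\<in>edges H. weight G (g ` e) = weight H e" by (elim exE conjE)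
  then have w: "weight G (g ` e) = weight H e" if "e \<in> edges H" for e using that by blast
  define f where "f = the_inv_into (verts H) g"
  have f: "bij_betw f (verts G) (verts H)" unfolding f_def using g by (rule bij_betw_the_inv_into)
  have gf: "g (f t) = t" if "t \<in> verts G" for t
    unfolding f_def using f_the_inv_into_f_bij_betw[OF g] that by blast
  have fg: "f (g s) = s" if "s \<in> verts H" for s
    unfolding f_def using the_inv_into_f_f[OF bij_betw_imp_inj_on[OF g] that] .
  have "({x, y} \<in> edges G \<longleftrightarrow> {f x, f y} \<in> edges H) \<and>
      ({x, y} \<in> edges G \<longrightarrow> weight G {x, y} = weight H {f x, f y})"
    if xy: "x \<in> verts G" "y \<in> verts G" for x y
  proof -
    have im: "{x, y} = g ` {f x, f y}" using gf xy by simp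
    have "{f x, f y} \<in> edges H" if xy': "{x, y} \<in> edges G"
    proof -
      obtain d where d: "d \<in> edges H" "{x, y} = g ` d" using xy' e by blast
      obtain s t where st: "s \<in> verts H" "t \<in> verts H" "d = {s, t}" using H[OF d(1)] by blast
      \<comment> \<open>As \<open>f\<close> inverts \<open>g\<close> on the vertices of
        \<open>H\<close>, the edge \<open>d\<close> is recovered from its image.\<close>
      have "{f x, f y} = f ` g ` d" using d(2) by (metis image_empty image_insert)
      also have "\<dots> = d" using st fg by simp
      finally show ?thesis using d(1) by simp
    qed
    moreover have "{x, y} \<in> edges G" if "{f x, f y} \<in> edges H" unfolding e im using that by (rule imageI)
    ultimately show ?thesis using w[of "{f x, f y}"] im by auto
  qed
  with f show "wgraph_iso G H" unfolding wgraph_iso_def by blast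
qed

lemma infinity414_eq: "infinity414 a b = wgraph_of
  [({Vv, Vx 1}, a 1), ({Vx 1, Vx 2}, a 2), ({Vx 2, Vx 3}, a 3), ({Vx 3, Vv}, a 4),
   ({Vv, Vy 1}, b 1), ({Vy 1, Vy 2}, b 2), ({Vy 2, Vy 3}, b 3), ({Vy 3, Vv}, b 4)]"
  by (simp add: infinity414_def weighted_walk_def)

lemma theta_111_eq: "theta 1 1 1 a b c = wgraph_of
  [({Vu, Vx 1}, a 1), ({Vx 1, Vv}, a 2), ({Vu, Vy 1}, b 1), ({Vy 1, Vv}, b 2),
   ({Vu, Vz 1}, c 1), ({Vz 1, Vv}, c 2)]"
  by (simp add: theta_def weighted_walk_def upt_rec numeral_2_eq_2)

lemma theta_101_eq: "theta 1 0 1 a b c = wgraph_of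
  [({Vu, Vx 1}, a 1), ({Vx 1, Vv}, a 2), ({Vu, Vv}, b 1), ({Vu, Vz 1}, c 1), ({Vz 1, Vv}, c 2)]"
  by (simp add: theta_def weighted_walk_def upt_rec numeral_2_eq_2)

lemma theta_102_eq: "theta 1 0 2 a b c = wgraph_of
  [({Vu, Vx 1}, a 1), ({Vx 1, Vv}, a 2), ({Vu, Vv}, b 1),
   ({Vu, Vz 1}, c 1), ({Vz 1, Vz 2}, c 2), ({Vz 2, Vv}, c 3)]"
  by (simp add: theta_def weighted_walk_def upt_rec numeral_2_eq_2 numeral_3_eq_3)

lemma theta_202_eq: "theta 2 0 2 a b c = wgraph_of
  [({Vu, Vx 1}, a 1), ({Vx 1, Vx 2}, a 2), ({Vx 2, Vv}, a 3), ({Vu, Vv}, b 1),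
   ({Vu, Vz 1}, c 1), ({Vz 1, Vz 2}, c 2), ({Vz 2, Vv}, c 3)]"
  by (simp add: theta_def weighted_walk_def upt_rec numeral_2_eq_2 numeral_3_eq_3)

text \<open>With \<open>hs\<close> listing the vertices of the shape, bijectivity becomes
  distinctness of a list of images, and a concrete shape unfolds to a finite conjunction.
  Distinctness of the listed edges makes \<open>map_of\<close> return each listed weight.\<close>

lemma wgraph_iso_wgraph_of_iff:
  assumes G: "weighted_graph G"
    and d: "distinct (map fst es)" and two: "\<forall>(e, w)\<in>set es. card e = 2"
    and hs: "distinct hs" "set hs = \<Union> (fst ` set es)"
  shows "wgraph_iso G (wgraph_of es) \<longleftrightarrow> (\<exists>g. distinct (map g hs) \<and> verts G = set (map g hs) \<and>
    edges G = set (map (\<lambda>(e, w). g ` e) es) \<and> (\<forall>(e, w)\<in>set es. weight G (g ` e) = w))"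
proof -
  have G2: "\<exists>s\<in>verts G. \<exists>t\<in>verts G. e = {s, t}" if e: "e \<in> edges G" for e
  proof -
    have "e \<subseteq> verts G" "card e = 2" using G e by (simp_all add: weighted_graph_def)
    then obtain s t where "e = {s, t}" by (meson card_2_iff)
    then show ?thesis using \<open>e \<subseteq> verts G\<close> by auto
  qed
  have H2: "\<exists>s\<in>verts (wgraph_of es). \<exists>t\<in>verts (wgraph_of es). e = {s, t}"
    if e: "e \<in> edges (wgraph_of es)" for e
  proof -
    obtain w where w: "(e, w) \<in> set es" using e by (auto simp: wgraph_of_def)
    then have "card e = 2" using two by auto
    then obtain s t where st: "e = {s, t}" by (meson card_2_iff)
    have "e \<subseteq> verts (wgraph_of es)" using w by (force simp: wgraph_of_def)
    then show ?thesis using st by auto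
  qed
  have w: "weight (wgraph_of es) e = w" if "(e, w) \<in> set es" for e w
    using that d by (simp add: wgraph_of_def)
  have ball: "(\<forall>e\<in>edges (wgraph_of es). weight G (g ` e) = weight (wgraph_of es) e) \<longleftrightarrow>
      (\<forall>(e, w)\<in>set es. weight G (g ` e) = w)" for g
    using w by (auto simp: wgraph_of_def)
  have img: "(`) g ` edges (wgraph_of es) = set (map (\<lambda>(e, w). g ` e) es)" for g
    by (auto simp: wgraph_of_def image_image case_prod_unfold)
  have bij: "bij_betw g (verts (wgraph_of es)) (verts G) \<longleftrightarrow>
      distinct (map g hs) \<and> verts G = set (map g hs)" for g
    using hs by (auto simp: wgraph_of_def bij_betw_def distinct_map)
  show ?thesis by (simp only: wgraph_iso_iff[OF G2 H2] ball img bij conj_assoc)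
qed

text \<open>At the indices that occur, the weight sequences are determined by \<open>G\<close> and
  the naming of its vertices, so they can be eliminated and the condition read off from the weights
  of \<open>G\<close>. The theta shapes below follow the same scheme.\<close>

lemma infinity414_iso_iff:
  assumes G: "weighted_graph G"
  shows "(\<exists>a b. wgraph_iso G (infinity414 a b) \<and> (a 1 * a 3 = a 2 * a 4 \<and> b 1 * b 3 = b 2 * b 4)) \<longleftrightarrow>
    (\<exists>v x1 x2 x3 y1 y2 y3. distinct [v, x1, x2, x3, y1, y2, y3] \<and> verts G = {v, x1, x2, x3, y1, y2, y3} \<and>
      edges G = {{v, x1}, {x1, x2}, {x2, x3}, {x3, v}, {v, y1}, {y1, y2}, {y2, y3}, {y3, v}} \<and>
      (weight G {v, x1} * weight G {x2, x3} = weight G {x1, x2} * weight G {x3, v} \<and>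
       weight G {v, y1} * weight G {y2, y3} = weight G {y1, y2} * weight G {y3, v}))" (is "?L \<longleftrightarrow> ?R")
proof -
  have iso: "wgraph_iso G (infinity414 a b) \<longleftrightarrow>
    (\<exists>g. distinct (map g [Vv, Vx 1, Vx 2, Vx 3, Vy 1, Vy 2, Vy 3]) \<and>
      verts G = {g Vv, g (Vx 1), g (Vx 2), g (Vx 3), g (Vy 1), g (Vy 2), g (Vy 3)} \<and>
      edges G = {{g Vv, g (Vx 1)}, {g (Vx 1), g (Vx 2)}, {g (Vx 2), g (Vx 3)}, {g (Vx 3), g Vv}, {g Vv, g (Vy 1)}, {g (Vy 1), g (Vy 2)}, {g (Vy 2), g (Vy 3)}, {g (Vy 3), g Vv}} \<and>
      weight G {g Vv, g (Vx 1)} = a 1 \<and>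
      weight G {g (Vx 1), g (Vx 2)} = a 2 \<and>
      weight G {g (Vx 2), g (Vx 3)} = a 3 \<and>
      weight G {g (Vx 3), g Vv} = a 4 \<and>
      weight G {g Vv, g (Vy 1)} = b 1 \<and>
      weight G {g (Vy 1), g (Vy 2)} = b 2 \<and>
      weight G {g (Vy 2), g (Vy 3)} = b 3 \<and>
      weight G {g (Vy 3), g Vv} = b 4)" for a b
    unfolding infinity414_eq
    by (subst wgraph_iso_wgraph_of_iff[OF G, where hs = "[Vv, Vx 1, Vx 2, Vx 3, Vy 1, Vy 2, Vy 3]"])
      (auto simp: doubleton_eq_iff)
  show ?thesis
  proof
    assume ?L
    then obtain a b :: "nat \<Rightarrow> real" and g where g: "distinct (map g [Vv, Vx 1, Vx 2, Vx 3, Vy 1, Vy 2, Vy 3])"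
      "verts G = {g Vv, g (Vx 1), g (Vx 2), g (Vx 3), g (Vy 1), g (Vy 2), g (Vy 3)}"
      "edges G = {{g Vv, g (Vx 1)}, {g (Vx 1), g (Vx 2)}, {g (Vx 2), g (Vx 3)}, {g (Vx 3), g Vv}, {g Vv, g (Vy 1)}, {g (Vy 1), g (Vy 2)}, {g (Vy 2), g (Vy 3)}, {g (Vy 3), g Vv}}"
      and w: "weight G {g Vv, g (Vx 1)} = a 1"
        "weight G {g (Vx 1), g (Vx 2)} = a 2"
        "weight G {g (Vx 2), g (Vx 3)} = a 3"
        "weight G {g (Vx 3), g Vv} = a 4"
        "weight G {g Vv, g (Vy 1)} = b 1"
        "weight G {g (Vy 1), g (Vy 2)} = b 2"
        "weight G {g (Vy 2), g (Vy 3)} = b 3"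
        "weight G {g (Vy 3), g Vv} = b 4"
      and c: "a 1 * a 3 = a 2 * a 4 \<and> b 1 * b 3 = b 2 * b 4"
      unfolding iso by (elim exE conjE) (rule that; (intro conjI)?; assumption)
    show ?R
      by (rule exI[of _ "g Vv"],
          rule exI[of _ "g (Vx 1)"],
          rule exI[of _ "g (Vx 2)"],
          rule exI[of _ "g (Vx 3)"],
          rule exI[of _ "g (Vy 1)"],
          rule exI[of _ "g (Vy 2)"],
          rule exI[of _ "g (Vy 3)"],
          intro conjI)
        (use g(1) in simp, rule g(2), rule g(3), unfold w, use c in simp_all)
  next
    assume ?R
    then obtain v x1 x2 x3 y1 y2 y3 where d: "distinct [v, x1, x2, x3, y1, y2, y3]"
      and V: "verts G = {v, x1, x2, x3, y1, y2, y3}"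
      and E: "edges G = {{v, x1}, {x1, x2}, {x2, x3}, {x3, v}, {v, y1}, {y1, y2}, {y2, y3}, {y3, v}}"
      and w: "weight G {v, x1} * weight G {x2, x3} = weight G {x1, x2} * weight G {x3, v} \<and>
       weight G {v, y1} * weight G {y2, y3} = weight G {y1, y2} * weight G {y3, v}"
      by (elim exE conjE) (rule that; (intro conjI)?; assumption)
    \<comment> \<open>Constructors and indices that do not occur in the shape receive arbitrary
      defaults, here and in \<open>a\<close> and \<open>b\<close> below.\<close>
    define g where "g = case_bvertex v v (\<lambda>i. if i = 1 then x1 else if i = 2 then x2 else x3)
      (\<lambda>i. if i = 1 then y1 else if i = 2 then y2 else y3) (\<lambda>i. v)"
    define a where "a = (\<lambda>i::nat. weight G (if i = 1 then {v, x1} else if i = 2 then {x1, x2} else if i = 3 then {x2, x3} else {x3, v}))"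
    define b where "b = (\<lambda>i::nat. weight G (if i = 1 then {v, y1} else if i = 2 then {y1, y2} else if i = 3 then {y2, y3} else {y3, v}))"
    have g: "g Vv = v" "g (Vx 1) = x1" "g (Vx 2) = x2" "g (Vx 3) = x3" "g (Vy 1) = y1" "g (Vy 2) = y2" "g (Vy 3) = y3"
      by (simp_all add: g_def)
    have ws: "a 1 = weight G {v, x1}"
      "a 2 = weight G {x1, x2}"
      "a 3 = weight G {x2, x3}"
      "a 4 = weight G {x3, v}"
      "b 1 = weight G {v, y1}"
      "b 2 = weight G {y1, y2}"
      "b 3 = weight G {y2, y3}"
      "b 4 = weight G {y3, v}"
      by (simp_all add: a_def b_def)
    have "wgraph_iso G (infinity414 a b)"
      unfolding iso by (rule exI[of _ g]) (simp only: g ws list.map d V E simp_thms)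
    moreover have "a 1 * a 3 = a 2 * a 4 \<and> b 1 * b 3 = b 2 * b 4" unfolding ws by (rule w)
    ultimately show ?L by blast
  qed
qed

lemma theta_111_iso_iff:
  assumes G: "weighted_graph G"
  shows "(\<exists>a b c. wgraph_iso G (theta 1 1 1 a b c) \<and> (a 2 * b 1 \<noteq> a 1 * b 2 \<or> a 2 * c 1 \<noteq> a 1 * c 2)) \<longleftrightarrow>
    (\<exists>u v x y z. distinct [u, v, x, y, z] \<and> verts G = {u, v, x, y, z} \<and>
      edges G = {{u, x}, {x, v}, {u, y}, {y, v}, {u, z}, {z, v}} \<and>
      (weight G {x, v} * weight G {u, y} \<noteq> weight G {u, x} * weight G {y, v} \<or>
       weight G {x, v} * weight G {u, z} \<noteq> weight G {u, x} * weight G {z, v}))" (is "?L \<longleftrightarrow> ?R")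
proof -
  have iso: "wgraph_iso G (theta 1 1 1 a b c) \<longleftrightarrow>
    (\<exists>g. distinct (map g [Vu, Vv, Vx 1, Vy 1, Vz 1]) \<and>
      verts G = {g Vu, g Vv, g (Vx 1), g (Vy 1), g (Vz 1)} \<and>
      edges G = {{g Vu, g (Vx 1)}, {g (Vx 1), g Vv}, {g Vu, g (Vy 1)}, {g (Vy 1), g Vv}, {g Vu, g (Vz 1)}, {g (Vz 1), g Vv}} \<and>
      weight G {g Vu, g (Vx 1)} = a 1 \<and>
      weight G {g (Vx 1), g Vv} = a 2 \<and>
      weight G {g Vu, g (Vy 1)} = b 1 \<and>
      weight G {g (Vy 1), g Vv} = b 2 \<and>
      weight G {g Vu, g (Vz 1)} = c 1 \<and>
      weight G {g (Vz 1), g Vv} = c 2)" for a b c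
    unfolding theta_111_eq
    by (subst wgraph_iso_wgraph_of_iff[OF G, where hs = "[Vu, Vv, Vx 1, Vy 1, Vz 1]"])
      (auto simp: doubleton_eq_iff)
  show ?thesis
  proof
    assume ?L
    then obtain a b c :: "nat \<Rightarrow> real" and g where g: "distinct (map g [Vu, Vv, Vx 1, Vy 1, Vz 1])"
      "verts G = {g Vu, g Vv, g (Vx 1), g (Vy 1), g (Vz 1)}"
      "edges G = {{g Vu, g (Vx 1)}, {g (Vx 1), g Vv}, {g Vu, g (Vy 1)}, {g (Vy 1), g Vv}, {g Vu, g (Vz 1)}, {g (Vz 1), g Vv}}"
      and w: "weight G {g Vu, g (Vx 1)} = a 1"
        "weight G {g (Vx 1), g Vv} = a 2"
        "weight G {g Vu, g (Vy 1)} = b 1"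
        "weight G {g (Vy 1), g Vv} = b 2"
        "weight G {g Vu, g (Vz 1)} = c 1"
        "weight G {g (Vz 1), g Vv} = c 2"
      and c: "a 2 * b 1 \<noteq> a 1 * b 2 \<or> a 2 * c 1 \<noteq> a 1 * c 2"
      unfolding iso by (elim exE conjE) (rule that; (intro conjI)?; assumption)
    show ?R
      by (rule exI[of _ "g Vu"],
          rule exI[of _ "g Vv"],
          rule exI[of _ "g (Vx 1)"],
          rule exI[of _ "g (Vy 1)"],
          rule exI[of _ "g (Vz 1)"],
          intro conjI)
        (use g(1) in simp, rule g(2), rule g(3), unfold w, use c in simp_all)
  next
    assume ?R
    then obtain u v x y z where d: "distinct [u, v, x, y, z]"
      and V: "verts G = {u, v, x, y, z}"
      and E: "edges G = {{u, x}, {x, v}, {u, y}, {y, v}, {u, z}, {z, v}}"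
      and w: "weight G {x, v} * weight G {u, y} \<noteq> weight G {u, x} * weight G {y, v} \<or>
       weight G {x, v} * weight G {u, z} \<noteq> weight G {u, x} * weight G {z, v}"
      by (elim exE conjE) (rule that; (intro conjI)?; assumption)
    define g where "g = case_bvertex u v (\<lambda>i. x)
      (\<lambda>i. y) (\<lambda>i. z)"
    define a where "a = (\<lambda>i::nat. weight G (if i = 1 then {u, x} else {x, v}))"
    define b where "b = (\<lambda>i::nat. weight G (if i = 1 then {u, y} else {y, v}))"
    define c where "c = (\<lambda>i::nat. weight G (if i = 1 then {u, z} else {z, v}))"
    have g: "g Vu = u" "g Vv = v" "g (Vx 1) = x" "g (Vy 1) = y" "g (Vz 1) = z"
      by (simp_all add: g_def)
    have ws: "a 1 = weight G {u, x}"
      "a 2 = weight G {x, v}"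
      "b 1 = weight G {u, y}"
      "b 2 = weight G {y, v}"
      "c 1 = weight G {u, z}"
      "c 2 = weight G {z, v}"
      by (simp_all add: a_def b_def c_def)
    have "wgraph_iso G (theta 1 1 1 a b c)"
      unfolding iso by (rule exI[of _ g]) (simp only: g ws list.map d V E simp_thms)
    moreover have "a 2 * b 1 \<noteq> a 1 * b 2 \<or> a 2 * c 1 \<noteq> a 1 * c 2" unfolding ws by (rule w)
    ultimately show ?L by blast
  qed
qed

lemma theta_101_iso_iff:
  assumes G: "weighted_graph G"
  shows "(\<exists>a b c. wgraph_iso G (theta 1 0 1 a b c) \<and> (a 2 * c 1 \<noteq> a 1 * c 2)) \<longleftrightarrow>
    (\<exists>u v x z. distinct [u, v, x, z] \<and> verts G = {u, v, x, z} \<and>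
      edges G = {{u, x}, {x, v}, {u, v}, {u, z}, {z, v}} \<and>
      (weight G {x, v} * weight G {u, z} \<noteq> weight G {u, x} * weight G {z, v}))" (is "?L \<longleftrightarrow> ?R")
proof -
  have iso: "wgraph_iso G (theta 1 0 1 a b c) \<longleftrightarrow>
    (\<exists>g. distinct (map g [Vu, Vv, Vx 1, Vz 1]) \<and>
      verts G = {g Vu, g Vv, g (Vx 1), g (Vz 1)} \<and>
      edges G = {{g Vu, g (Vx 1)}, {g (Vx 1), g Vv}, {g Vu, g Vv}, {g Vu, g (Vz 1)}, {g (Vz 1), g Vv}} \<and>
      weight G {g Vu, g (Vx 1)} = a 1 \<and>
      weight G {g (Vx 1), g Vv} = a 2 \<and>
      weight G {g Vu, g Vv} = b 1 \<and>
      weight G {g Vu, g (Vz 1)} = c 1 \<and>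
      weight G {g (Vz 1), g Vv} = c 2)" for a b c
    unfolding theta_101_eq
    by (subst wgraph_iso_wgraph_of_iff[OF G, where hs = "[Vu, Vv, Vx 1, Vz 1]"])
      (auto simp: doubleton_eq_iff)
  show ?thesis
  proof
    assume ?L
    then obtain a b c :: "nat \<Rightarrow> real" and g where g: "distinct (map g [Vu, Vv, Vx 1, Vz 1])"
      "verts G = {g Vu, g Vv, g (Vx 1), g (Vz 1)}"
      "edges G = {{g Vu, g (Vx 1)}, {g (Vx 1), g Vv}, {g Vu, g Vv}, {g Vu, g (Vz 1)}, {g (Vz 1), g Vv}}"
      and w: "weight G {g Vu, g (Vx 1)} = a 1"
        "weight G {g (Vx 1), g Vv} = a 2"
        "weight G {g Vu, g Vv} = b 1"
        "weight G {g Vu, g (Vz 1)} = c 1"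
        "weight G {g (Vz 1), g Vv} = c 2"
      and c: "a 2 * c 1 \<noteq> a 1 * c 2"
      unfolding iso by (elim exE conjE) (rule that; (intro conjI)?; assumption)
    show ?R
      by (rule exI[of _ "g Vu"],
          rule exI[of _ "g Vv"],
          rule exI[of _ "g (Vx 1)"],
          rule exI[of _ "g (Vz 1)"],
          intro conjI)
        (use g(1) in simp, rule g(2), rule g(3), unfold w, use c in simp_all)
  next
    assume ?R
    then obtain u v x z where d: "distinct [u, v, x, z]"
      and V: "verts G = {u, v, x, z}"
      and E: "edges G = {{u, x}, {x, v}, {u, v}, {u, z}, {z, v}}"
      and w: "weight G {x, v} * weight G {u, z} \<noteq> weight G {u, x} * weight G {z, v}"
      by (elim exE conjE) (rule that; (intro conjI)?; assumption)
    define g where "g = case_bvertex u v (\<lambda>i. x)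
      (\<lambda>i. u) (\<lambda>i. z)"
    define a where "a = (\<lambda>i::nat. weight G (if i = 1 then {u, x} else {x, v}))"
    define b where "b = (\<lambda>i::nat. weight G ({u, v}))"
    define c where "c = (\<lambda>i::nat. weight G (if i = 1 then {u, z} else {z, v}))"
    have g: "g Vu = u" "g Vv = v" "g (Vx 1) = x" "g (Vz 1) = z"
      by (simp_all add: g_def)
    have ws: "a 1 = weight G {u, x}"
      "a 2 = weight G {x, v}"
      "b 1 = weight G {u, v}"
      "c 1 = weight G {u, z}"
      "c 2 = weight G {z, v}"
      by (simp_all add: a_def b_def c_def)
    have "wgraph_iso G (theta 1 0 1 a b c)"
      unfolding iso by (rule exI[of _ g]) (simp only: g ws list.map d V E simp_thms)
    moreover have "a 2 * c 1 \<noteq> a 1 * c 2" unfolding ws by (rule w)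
    ultimately show ?L by blast
  qed
qed

lemma theta_102_iso_iff:
  assumes G: "weighted_graph G"
  shows "(\<exists>a b c. wgraph_iso G (theta 1 0 2 a b c) \<and> (b 1 * c 2 = c 1 * c 3)) \<longleftrightarrow>
    (\<exists>u v x z1 z2. distinct [u, v, x, z1, z2] \<and> verts G = {u, v, x, z1, z2} \<and>
      edges G = {{u, x}, {x, v}, {u, v}, {u, z1}, {z1, z2}, {z2, v}} \<and>
      (weight G {u, v} * weight G {z1, z2} = weight G {u, z1} * weight G {z2, v}))" (is "?L \<longleftrightarrow> ?R")
proof -
  have iso: "wgraph_iso G (theta 1 0 2 a b c) \<longleftrightarrow>
    (\<exists>g. distinct (map g [Vu, Vv, Vx 1, Vz 1, Vz 2]) \<and>
      verts G = {g Vu, g Vv, g (Vx 1), g (Vz 1), g (Vz 2)} \<and>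
      edges G = {{g Vu, g (Vx 1)}, {g (Vx 1), g Vv}, {g Vu, g Vv}, {g Vu, g (Vz 1)}, {g (Vz 1), g (Vz 2)}, {g (Vz 2), g Vv}} \<and>
      weight G {g Vu, g (Vx 1)} = a 1 \<and>
      weight G {g (Vx 1), g Vv} = a 2 \<and>
      weight G {g Vu, g Vv} = b 1 \<and>
      weight G {g Vu, g (Vz 1)} = c 1 \<and>
      weight G {g (Vz 1), g (Vz 2)} = c 2 \<and>
      weight G {g (Vz 2), g Vv} = c 3)" for a b c
    unfolding theta_102_eq
    by (subst wgraph_iso_wgraph_of_iff[OF G, where hs = "[Vu, Vv, Vx 1, Vz 1, Vz 2]"])
      (auto simp: doubleton_eq_iff)
  show ?thesis
  proof
    assume ?L
    then obtain a b c :: "nat \<Rightarrow> real" and g where g: "distinct (map g [Vu, Vv, Vx 1, Vz 1, Vz 2])"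
      "verts G = {g Vu, g Vv, g (Vx 1), g (Vz 1), g (Vz 2)}"
      "edges G = {{g Vu, g (Vx 1)}, {g (Vx 1), g Vv}, {g Vu, g Vv}, {g Vu, g (Vz 1)}, {g (Vz 1), g (Vz 2)}, {g (Vz 2), g Vv}}"
      and w: "weight G {g Vu, g (Vx 1)} = a 1"
        "weight G {g (Vx 1), g Vv} = a 2"
        "weight G {g Vu, g Vv} = b 1"
        "weight G {g Vu, g (Vz 1)} = c 1"
        "weight G {g (Vz 1), g (Vz 2)} = c 2"
        "weight G {g (Vz 2), g Vv} = c 3"
      and c: "b 1 * c 2 = c 1 * c 3"
      unfolding iso by (elim exE conjE) (rule that; (intro conjI)?; assumption)
    show ?R
      by (rule exI[of _ "g Vu"],
          rule exI[of _ "g Vv"],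
          rule exI[of _ "g (Vx 1)"],
          rule exI[of _ "g (Vz 1)"],
          rule exI[of _ "g (Vz 2)"],
          intro conjI)
        (use g(1) in simp, rule g(2), rule g(3), unfold w, use c in simp_all)
  next
    assume ?R
    then obtain u v x z1 z2 where d: "distinct [u, v, x, z1, z2]"
      and V: "verts G = {u, v, x, z1, z2}"
      and E: "edges G = {{u, x}, {x, v}, {u, v}, {u, z1}, {z1, z2}, {z2, v}}"
      and w: "weight G {u, v} * weight G {z1, z2} = weight G {u, z1} * weight G {z2, v}"
      by (elim exE conjE) (rule that; (intro conjI)?; assumption)
    define g where "g = case_bvertex u v (\<lambda>i. x)
      (\<lambda>i. u) (\<lambda>i. if i = 1 then z1 else z2)"
    define a where "a = (\<lambda>i::nat. weight G (if i = 1 then {u, x} else {x, v}))"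
    define b where "b = (\<lambda>i::nat. weight G ({u, v}))"
    define c where "c = (\<lambda>i::nat. weight G (if i = 1 then {u, z1} else if i = 2 then {z1, z2} else {z2, v}))"
    have g: "g Vu = u" "g Vv = v" "g (Vx 1) = x" "g (Vz 1) = z1" "g (Vz 2) = z2"
      by (simp_all add: g_def)
    have ws: "a 1 = weight G {u, x}"
      "a 2 = weight G {x, v}"
      "b 1 = weight G {u, v}"
      "c 1 = weight G {u, z1}"
      "c 2 = weight G {z1, z2}"
      "c 3 = weight G {z2, v}"
      by (simp_all add: a_def b_def c_def)
    have "wgraph_iso G (theta 1 0 2 a b c)"
      unfolding iso by (rule exI[of _ g]) (simp only: g ws list.map d V E simp_thms)
    moreover have "b 1 * c 2 = c 1 * c 3" unfolding ws by (rule w)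
    ultimately show ?L by blast
  qed
qed

lemma theta_202_iso_iff:
  assumes G: "weighted_graph G"
  shows "(\<exists>a b c. wgraph_iso G (theta 2 0 2 a b c) \<and> (a 2 * b 1 * c 2 - a 1 * a 3 * c 2 - a 2 * c 1 * c 3 = 0)) \<longleftrightarrow>
    (\<exists>u v x1 x2 z1 z2. distinct [u, v, x1, x2, z1, z2] \<and> verts G = {u, v, x1, x2, z1, z2} \<and>
      edges G = {{u, x1}, {x1, x2}, {x2, v}, {u, v}, {u, z1}, {z1, z2}, {z2, v}} \<and>
      (weight G {x1, x2} * weight G {u, v} * weight G {z1, z2} - weight G {u, x1} * weight G {x2, v} * weight G {z1, z2} -
       weight G {x1, x2} * weight G {u, z1} * weight G {z2, v} = 0))" (is "?L \<longleftrightarrow> ?R")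
proof -
  have iso: "wgraph_iso G (theta 2 0 2 a b c) \<longleftrightarrow>
    (\<exists>g. distinct (map g [Vu, Vv, Vx 1, Vx 2, Vz 1, Vz 2]) \<and>
      verts G = {g Vu, g Vv, g (Vx 1), g (Vx 2), g (Vz 1), g (Vz 2)} \<and>
      edges G = {{g Vu, g (Vx 1)}, {g (Vx 1), g (Vx 2)}, {g (Vx 2), g Vv}, {g Vu, g Vv}, {g Vu, g (Vz 1)}, {g (Vz 1), g (Vz 2)}, {g (Vz 2), g Vv}} \<and>
      weight G {g Vu, g (Vx 1)} = a 1 \<and>
      weight G {g (Vx 1), g (Vx 2)} = a 2 \<and>
      weight G {g (Vx 2), g Vv} = a 3 \<and>
      weight G {g Vu, g Vv} = b 1 \<and>
      weight G {g Vu, g (Vz 1)} = c 1 \<and>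
      weight G {g (Vz 1), g (Vz 2)} = c 2 \<and>
      weight G {g (Vz 2), g Vv} = c 3)" for a b c
    unfolding theta_202_eq
    by (subst wgraph_iso_wgraph_of_iff[OF G, where hs = "[Vu, Vv, Vx 1, Vx 2, Vz 1, Vz 2]"])
      (auto simp: doubleton_eq_iff)
  show ?thesis
  proof
    assume ?L
    then obtain a b c :: "nat \<Rightarrow> real" and g where g: "distinct (map g [Vu, Vv, Vx 1, Vx 2, Vz 1, Vz 2])"
      "verts G = {g Vu, g Vv, g (Vx 1), g (Vx 2), g (Vz 1), g (Vz 2)}"
      "edges G = {{g Vu, g (Vx 1)}, {g (Vx 1), g (Vx 2)}, {g (Vx 2), g Vv}, {g Vu, g Vv}, {g Vu, g (Vz 1)}, {g (Vz 1), g (Vz 2)}, {g (Vz 2), g Vv}}"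
      and w: "weight G {g Vu, g (Vx 1)} = a 1"
        "weight G {g (Vx 1), g (Vx 2)} = a 2"
        "weight G {g (Vx 2), g Vv} = a 3"
        "weight G {g Vu, g Vv} = b 1"
        "weight G {g Vu, g (Vz 1)} = c 1"
        "weight G {g (Vz 1), g (Vz 2)} = c 2"
        "weight G {g (Vz 2), g Vv} = c 3"
      and c: "a 2 * b 1 * c 2 - a 1 * a 3 * c 2 - a 2 * c 1 * c 3 = 0"
      unfolding iso by (elim exE conjE) (rule that; (intro conjI)?; assumption)
    show ?R
      by (rule exI[of _ "g Vu"],
          rule exI[of _ "g Vv"],
          rule exI[of _ "g (Vx 1)"],
          rule exI[of _ "g (Vx 2)"],
          rule exI[of _ "g (Vz 1)"],
          rule exI[of _ "g (Vz 2)"],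
          intro conjI)
        (use g(1) in simp, rule g(2), rule g(3), unfold w, use c in simp_all)
  next
    assume ?R
    then obtain u v x1 x2 z1 z2 where d: "distinct [u, v, x1, x2, z1, z2]"
      and V: "verts G = {u, v, x1, x2, z1, z2}"
      and E: "edges G = {{u, x1}, {x1, x2}, {x2, v}, {u, v}, {u, z1}, {z1, z2}, {z2, v}}"
      and w: "weight G {x1, x2} * weight G {u, v} * weight G {z1, z2} - weight G {u, x1} * weight G {x2, v} * weight G {z1, z2} -
       weight G {x1, x2} * weight G {u, z1} * weight G {z2, v} = 0"
      by (elim exE conjE) (rule that; (intro conjI)?; assumption)
    define g where "g = case_bvertex u v (\<lambda>i. if i = 1 then x1 else x2)
      (\<lambda>i. u) (\<lambda>i. if i = 1 then z1 else z2)"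
    define a where "a = (\<lambda>i::nat. weight G (if i = 1 then {u, x1} else if i = 2 then {x1, x2} else {x2, v}))"
    define b where "b = (\<lambda>i::nat. weight G ({u, v}))"
    define c where "c = (\<lambda>i::nat. weight G (if i = 1 then {u, z1} else if i = 2 then {z1, z2} else {z2, v}))"
    have g: "g Vu = u" "g Vv = v" "g (Vx 1) = x1" "g (Vx 2) = x2" "g (Vz 1) = z1" "g (Vz 2) = z2"
      by (simp_all add: g_def)
    have ws: "a 1 = weight G {u, x1}"
      "a 2 = weight G {x1, x2}"
      "a 3 = weight G {x2, v}"
      "b 1 = weight G {u, v}"
      "c 1 = weight G {u, z1}"
      "c 2 = weight G {z1, z2}"
      "c 3 = weight G {z2, v}"
      by (simp_all add: a_def b_def c_def)
    have "wgraph_iso G (theta 2 0 2 a b c)"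
      unfolding iso by (rule exI[of _ g]) (simp only: g ws list.map d V E simp_thms)
    moreover have "a 2 * b 1 * c 2 - a 1 * a 3 * c 2 - a 2 * c 1 * c 3 = 0" unfolding ws by (rule w)
    ultimately show ?L by blast
  qed
qed

section \<open>Ranks of the shapes\<close>

lemma adj_pos: "weighted_graph G \<Longrightarrow> {s, t} \<in> edges G \<Longrightarrow> adj G s t = weight G {s, t} \<and> 0 < adj G s t"
  by (simp add: adj_def weighted_graph_def)

lemma adj_sym: "adj G s t = w \<Longrightarrow> adj G t s = w"
  by (simp only: adj_def insert_commute[of s t "{}"])

text \<open>Multiplying the system by the adjugate of its matrix isolates the determinant times each
  unknown.\<close>

lemma cramer_2:
  fixes a b c d x y :: real
  assumes "a * x + b * y = 0" "c * x + d * y = 0" "a * d \<noteq> b * c"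
  shows "x = 0" "y = 0"
proof -
  have "(a * d - b * c) * x = d * (a * x + b * y) - b * (c * x + d * y)"
    "(a * d - b * c) * y = a * (c * x + d * y) - c * (a * x + b * y)"
    by (simp_all add: algebra_simps)
  then have "(a * d - b * c) * x = 0" "(a * d - b * c) * y = 0" unfolding assms(1,2) by simp_all
  then show "x = 0" "y = 0" using assms(3) by simp_all
qed

context
  fixes G :: "'a wgraph" and vs :: "'a list"
  assumes G: "weighted_graph G" and vs: "distinct vs" "set vs = verts G"
begin

text \<open>The triangle on \<open>u\<close>, \<open>v\<close>, \<open>x\<close> is nonsingular, so
  the rank is 3 or 4. Equality of the two products makes column \<open>z\<close> a multiple of
  column \<open>x\<close>; otherwise rows \<open>x\<close> and \<open>z\<close> annihilate
  \<open>f u\<close> and \<open>f v\<close>, and rows \<open>u\<close> and \<open>v\<close> then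
  annihilate the rest.\<close>

lemma theta_101_rank:
  assumes d: "distinct [u, v, x, z]" and V: "verts G = {u, v, x, z}"
    and E: "edges G = {{u, x}, {x, v}, {u, v}, {u, z}, {z, v}}"
  shows "matrix_rank (adjacency_matrix G vs) = 4 \<longleftrightarrow>
    weight G {x, v} * weight G {u, z} \<noteq> weight G {u, x} * weight G {z, v}"
proof -
  \<comment> \<open>\<open>distinct\<close> gives each inequality in one orientation; the reversed
    list adds the other one for the simplifier.\<close>
  have d': "distinct (rev [u, v, x, z])" unfolding distinct_rev by (rule d)
  define a1 a2 b c1 c2 where w: "a1 = weight G {u, x}" "a2 = weight G {x, v}" "b = weight G {u, v}"
    "c1 = weight G {u, z}" "c2 = weight G {z, v}"
  have pos: "a1 > 0" "a2 > 0" "b > 0" "c1 > 0" "c2 > 0"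
    using G by (simp_all add: w weighted_graph_def E)
  have e: "adj G u x = a1" "adj G x v = a2" "adj G u v = b" "adj G u z = c1" "adj G z v = c2"
    by (simp_all add: adj_def E w)
  have z: "adj G u u = 0" "adj G v v = 0" "adj G x x = 0" "adj G x z = 0" "adj G z z = 0"
    using d d' by (simp_all add: adj_def E doubleton_eq_iff)
  note adj = e e[THEN adj_sym] z z[THEN adj_sym]
  show ?thesis
  proof (cases "a2 * c1 = a1 * c2")
    case True
    have "matrix_rank (adjacency_matrix G vs) = card {u, v, x}"
    proof (rule adjacency_rank_eq_card[OF vs])
      fix f k assume "\<forall>t\<in>verts G. (\<Sum>k\<in>{u, v, x}. adj G t k * f k) = 0" and k: "k \<in> {u, v, x}"
      then have r: "a1 * f u + a2 * f v = 0" "b * f v + a1 * f x = 0" "b * f u + a2 * f x = 0"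
        using d d' by (simp_all add: V adj)
      \<comment> \<open>This combination cancels \<open>f v\<close> and \<open>f x\<close>. The
        surviving factor 2 is that of the determinant \<open>2 * a1 * a2 * b\<close> of the
        triangle.\<close>
      have "2 * (a1 * b * f u) = b * (a1 * f u + a2 * f v) + a1 * (b * f u + a2 * f x) - a2 * (b * f v + a1 * f x)"
        by (simp add: algebra_simps)
      then have u: "f u = 0" using pos unfolding r by simp
      then have "f v = 0" "f x = 0" using r(1,3) pos by simp_all
      then show "f k = 0" using k u by auto
    next
      fix t assume "t \<in> verts G" "t \<notin> {u, v, x}"
      then have "t = z" using V by auto
      then show "\<exists>f. \<forall>s\<in>verts G. adj G s t = (\<Sum>k\<in>{u, v, x}. adj G s k * f k)"
        using d pos True by (intro exI[of _ "\<lambda>k. if k = x then c1 / a1 else 0"]) (auto simp: V adj field_simps)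
    qed (simp add: V)
    then show ?thesis using d True by (simp add: w)
  next
    case False
    have "matrix_rank (adjacency_matrix G vs) = card {u, v, x, z}"
    proof (rule adjacency_rank_eq_card[OF vs])
      fix f k assume "\<forall>t\<in>verts G. (\<Sum>k\<in>{u, v, x, z}. adj G t k * f k) = 0" and k: "k \<in> {u, v, x, z}"
      then have r: "a1 * f u + a2 * f v = 0" "c1 * f u + c2 * f v = 0"
          "b * f v + (a1 * f x + c1 * f z) = 0" "b * f u + (a2 * f x + c2 * f z) = 0"
        using d d' by (simp_all add: V adj)
      have ne: "a1 * c2 \<noteq> a2 * c1" "a1 * c2 \<noteq> c1 * a2" using False by (simp_all add: mult.commute)
      have uv: "f u = 0" "f v = 0" using cramer_2[OF r(1,2) ne(1)] .
      then have "a1 * f x + c1 * f z = 0" "a2 * f x + c2 * f z = 0" using r(3,4) by simp_all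
      from cramer_2[OF this ne(2)] have "f x = 0" "f z = 0" .
      with uv show "f k = 0" using k by auto
    qed (simp_all add: V)
    then show ?thesis using d False by (simp add: w)
  qed
qed

text \<open>All edges run between {u, v} and {x, y, z}, so the rank is twice that of a 2 by 3 block.
  The inequality says that the minor on columns \<open>x\<close> and \<open>y\<close> does not
  vanish.\<close>

lemma theta_111_rank_4:
  assumes d: "distinct [u, v, x, y, z]" and V: "verts G = {u, v, x, y, z}"
    and E: "edges G = {{u, x}, {x, v}, {u, y}, {y, v}, {u, z}, {z, v}}"
    and ne: "weight G {x, v} * weight G {u, y} \<noteq> weight G {u, x} * weight G {y, v}"
  shows "matrix_rank (adjacency_matrix G vs) = 4"
proof -
  have d': "distinct (rev [u, v, x, y, z])" unfolding distinct_rev by (rule d)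
  define a1 a2 b1 b2 c1 c2 where w: "a1 = weight G {u, x}" "a2 = weight G {x, v}"
    "b1 = weight G {u, y}" "b2 = weight G {y, v}" "c1 = weight G {u, z}" "c2 = weight G {z, v}"
  have e: "adj G u x = a1" "adj G x v = a2" "adj G u y = b1" "adj G y v = b2" "adj G u z = c1"
    "adj G z v = c2"
    by (simp_all add: adj_def E w)
  have z: "adj G u u = 0" "adj G u v = 0" "adj G v v = 0" "adj G x x = 0" "adj G x y = 0"
    "adj G x z = 0" "adj G y y = 0" "adj G y z = 0" "adj G z z = 0"
    using d d' by (simp_all add: adj_def E doubleton_eq_iff)
  note adj = e e[THEN adj_sym] z z[THEN adj_sym]
  have ne': "a1 * b2 - a2 * b1 \<noteq> 0" using ne by (simp add: w)
  have "matrix_rank (adjacency_matrix G vs) = card {u, v, x, y}"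
  proof (rule adjacency_rank_eq_card[OF vs])
    fix f k assume "\<forall>t\<in>verts G. (\<Sum>k\<in>{u, v, x, y}. adj G t k * f k) = 0" and k: "k \<in> {u, v, x, y}"
    then have r: "a1 * f u + a2 * f v = 0" "b1 * f u + b2 * f v = 0"
        "a1 * f x + b1 * f y = 0" "a2 * f x + b2 * f y = 0"
      using d d' by (simp_all add: V adj)
    have "f u = 0" "f v = 0" "f x = 0" "f y = 0"
      using cramer_2[OF r(1,2)] cramer_2[OF r(3,4)] ne' by (simp_all add: mult.commute)
    then show "f k = 0" using k by auto
  next
    fix t assume "t \<in> verts G" "t \<notin> {u, v, x, y}"
    then have "t = z" using V by auto
    \<comment> \<open>The coefficients of column \<open>z\<close> come from Cramer's rule.
      \<open>D\<close> stays folded while denominators are cleared and is unfolded only for the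
      final identity.\<close>
    define D where "D = a1 * b2 - a2 * b1"
    have "D \<noteq> 0" using ne' by (simp add: D_def)
    have "c1 = a1 * ((c1 * b2 - c2 * b1) / D) + b1 * ((a1 * c2 - a2 * c1) / D)"
      "c2 = a2 * ((c1 * b2 - c2 * b1) / D) + b2 * ((a1 * c2 - a2 * c1) / D)"
      using \<open>D \<noteq> 0\<close> by (simp_all add: field_simps) (simp_all add: D_def algebra_simps)
    then show "\<exists>f. \<forall>s\<in>verts G. adj G s t = (\<Sum>k\<in>{u, v, x, y}. adj G s k * f k)"
      using d d' \<open>t = z\<close>
      by (intro exI[of _ "\<lambda>k. if k = x then (c1 * b2 - c2 * b1) / D
        else if k = y then (a1 * c2 - a2 * c1) / D else 0"]) (simp add: V adj)
  qed (simp add: V)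
  then show ?thesis using d by simp
qed

text \<open>Exchanging \<open>y\<close> and \<open>z\<close> reduces the second alternative to the
  first. If both minors involving column \<open>x\<close> vanish, the 2 by 3 block has rank 1 and
  the whole matrix rank 2.\<close>

lemma theta_111_rank:
  assumes d: "distinct [u, v, x, y, z]" and V: "verts G = {u, v, x, y, z}"
    and E: "edges G = {{u, x}, {x, v}, {u, y}, {y, v}, {u, z}, {z, v}}"
  shows "matrix_rank (adjacency_matrix G vs) = 4 \<longleftrightarrow>
    weight G {x, v} * weight G {u, y} \<noteq> weight G {u, x} * weight G {y, v} \<or>
    weight G {x, v} * weight G {u, z} \<noteq> weight G {u, x} * weight G {z, v}" (is "?L \<longleftrightarrow> ?R1 \<or> ?R2")
proof
  assume "?R1 \<or> ?R2"
  moreover have d': "distinct [u, v, x, z, y]" and V': "verts G = {u, v, x, z, y}"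
      and E': "edges G = {{u, x}, {x, v}, {u, z}, {z, v}, {u, y}, {y, v}}"
    using d by (auto simp: V E)
  ultimately show ?L using theta_111_rank_4[OF d V E] theta_111_rank_4[OF d' V' E'] by (elim disjE)
next
  assume rank: ?L
  show "?R1 \<or> ?R2"
  proof (rule ccontr)
    assume "\<not> ?thesis"
    have d': "distinct (rev [u, v, x, y, z])" unfolding distinct_rev by (rule d)
    define a1 a2 b1 b2 c1 c2 where w: "a1 = weight G {u, x}" "a2 = weight G {x, v}"
      "b1 = weight G {u, y}" "b2 = weight G {y, v}" "c1 = weight G {u, z}" "c2 = weight G {z, v}"
    have pos: "a1 > 0" using G by (simp add: w weighted_graph_def E)
    have eq: "a2 * b1 = a1 * b2" "a2 * c1 = a1 * c2" using \<open>\<not> (?R1 \<or> ?R2)\<close> by (simp_all add: w)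
    have e: "adj G u x = a1" "adj G x v = a2" "adj G u y = b1" "adj G y v = b2" "adj G u z = c1"
      "adj G z v = c2"
      by (simp_all add: adj_def E w)
    have z: "adj G u u = 0" "adj G u v = 0" "adj G v v = 0" "adj G x x = 0" "adj G x y = 0"
      "adj G x z = 0" "adj G y y = 0" "adj G y z = 0" "adj G z z = 0"
      using d d' by (simp_all add: adj_def E doubleton_eq_iff)
    note adj = e e[THEN adj_sym] z z[THEN adj_sym]
    have "matrix_rank (adjacency_matrix G vs) = card {u, x}"
    proof (rule adjacency_rank_eq_card[OF vs])
      fix f k assume "\<forall>t\<in>verts G. (\<Sum>k\<in>{u, x}. adj G t k * f k) = 0" and k: "k \<in> {u, x}"
      then show "f k = 0" using d pos by (auto simp: V adj)
    next
      fix t assume "t \<in> verts G" "t \<notin> {u, x}"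
      then have "t = v \<or> t = y \<or> t = z" using V by auto
      \<comment> \<open>Rows \<open>x\<close> and \<open>u\<close> force the coefficients, since in
        each of them only one of the two chosen columns has a nonzero entry, namely
        \<open>a1\<close>. One formula therefore covers all three vertices \<open>t\<close>.\<close>
      then show "\<exists>f. \<forall>s\<in>verts G. adj G s t = (\<Sum>k\<in>{u, x}. adj G s k * f k)"
        using d pos eq
        by (intro exI[of _ "\<lambda>k. if k = u then adj G x t / a1 else adj G u t / a1"])
          (auto simp: V adj field_simps)
    qed (simp add: V)
    then show False using d rank by simp
  qed
qed

text \<open>The determinant is \<open>2 * a1 * a2 * c2 * (c1 * c3 - b * c2)\<close>: the 5-cycle,
  and the triangle together with the edge from \<open>z1\<close> to \<open>z2\<close>, contribute
  with opposite signs. When it vanishes, the path \<open>x\<close>, \<open>u\<close>,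
  \<open>z1\<close>, \<open>z2\<close> still provides four independent columns.\<close>

lemma theta_102_rank:
  assumes d: "distinct [u, v, x, z1, z2]" and V: "verts G = {u, v, x, z1, z2}"
    and E: "edges G = {{u, x}, {x, v}, {u, v}, {u, z1}, {z1, z2}, {z2, v}}"
  shows "matrix_rank (adjacency_matrix G vs) = 4 \<longleftrightarrow>
    weight G {u, v} * weight G {z1, z2} = weight G {u, z1} * weight G {z2, v}"
proof -
  have d': "distinct (rev [u, v, x, z1, z2])" unfolding distinct_rev by (rule d)
  define a1 a2 b c1 c2 c3 where w: "a1 = weight G {u, x}" "a2 = weight G {x, v}" "b = weight G {u, v}"
    "c1 = weight G {u, z1}" "c2 = weight G {z1, z2}" "c3 = weight G {z2, v}"
  have pos: "a1 > 0" "a2 > 0" "b > 0" "c1 > 0" "c2 > 0" "c3 > 0"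
    using G by (simp_all add: w weighted_graph_def E)
  have e: "adj G u x = a1" "adj G x v = a2" "adj G u v = b" "adj G u z1 = c1" "adj G z1 z2 = c2"
    "adj G z2 v = c3"
    by (simp_all add: adj_def E w)
  have z: "adj G u u = 0" "adj G u z2 = 0" "adj G v v = 0" "adj G v z1 = 0" "adj G x x = 0"
    "adj G x z1 = 0" "adj G x z2 = 0" "adj G z1 z1 = 0" "adj G z2 z2 = 0"
    using d d' by (simp_all add: adj_def E doubleton_eq_iff)
  note adj = e e[THEN adj_sym] z z[THEN adj_sym]
  show ?thesis unfolding w(1-6)[symmetric]
  proof
    assume "matrix_rank (adjacency_matrix G vs) = 4"
    then have "matrix_rank (adjacency_matrix G vs) < card {u, v, x, z1, z2}" using d by simp
    from adjacency_rank_less_imp_null_vector[OF vs _ this] V obtain f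
      where f: "\<exists>k\<in>{u, v, x, z1, z2}. f k \<noteq> 0"
      and null: "\<forall>t\<in>verts G. (\<Sum>k\<in>{u, v, x, z1, z2}. adj G t k * f k) = 0" by blast
    have r: "a1 * f u + a2 * f v = 0" "c1 * f u + c2 * f z2 = 0" "c3 * f v + c2 * f z1 = 0"
        "b * f v + (a1 * f x + c1 * f z1) = 0" "b * f u + (a2 * f x + c3 * f z2) = 0"
      using null d d' by (simp_all add: V adj)
    \<comment> \<open>A combination of all five rows in which only \<open>f v\<close> survives; its
      coefficient contains the critical factor of the determinant.\<close>
    have "2 * (a2 * f v * (c1 * c3 - b * c2)) =
        a1 * c2 * (b * f u + (a2 * f x + c3 * f z2)) - a2 * c2 * (b * f v + (a1 * f x + c1 * f z1))
        - b * c2 * (a1 * f u + a2 * f v) - a1 * c3 * (c1 * f u + c2 * f z2)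
        + c1 * c3 * (a1 * f u + a2 * f v) + a2 * c1 * (c3 * f v + c2 * f z1)"
      by (simp add: algebra_simps)
    then have "a2 * f v * (c1 * c3 - b * c2) = 0" unfolding r by simp
    moreover have "f v \<noteq> 0"
    proof
      assume "f v = 0"
      then have "f u = 0" "f z1 = 0" using r(1,3) pos by auto
      then have "f z2 = 0" "f x = 0" using \<open>f v = 0\<close> r(2,4) pos by auto
      then show False using f \<open>f v = 0\<close> \<open>f u = 0\<close> \<open>f z1 = 0\<close> by auto
    qed
    ultimately show "b * c2 = c1 * c3" using pos by auto
  next
    assume eq: "b * c2 = c1 * c3"
    have "matrix_rank (adjacency_matrix G vs) = card {u, x, z1, z2}"
    proof (rule adjacency_rank_eq_card[OF vs])
      fix f k assume null: "\<forall>t\<in>verts G. (\<Sum>k\<in>{u, x, z1, z2}. adj G t k * f k) = 0"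
        and k: "k \<in> {u, x, z1, z2}"
      have r: "f u = 0" "f z1 = 0" using null d d' pos by (simp_all add: V adj)
      then have "f z2 = 0" "f x = 0" using null d d' pos by (simp_all add: V adj)
      then show "f k = 0" using k r by auto
    next
      fix t assume "t \<in> verts G" "t \<notin> {u, x, z1, z2}"
      then have "t = v" using V by auto
      have b: "b = c1 * c3 / c2" using eq pos by (simp add: eq_divide_eq)
      \<comment> \<open>Rows \<open>x\<close>, \<open>z2\<close> and \<open>z1\<close> determine the
        coefficients of \<open>u\<close>, \<open>z1\<close> and \<open>z2\<close>; row
        \<open>u\<close> then gives \<open>x\<close> the coefficient 0, exactly because
        \<open>b = c1 * c3 / c2\<close>.\<close>
      show "\<exists>f. \<forall>s\<in>verts G. adj G s t = (\<Sum>k\<in>{u, x, z1, z2}. adj G s k * f k)"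
        using d d' pos \<open>t = v\<close>
        by (intro exI[of _ "\<lambda>k. if k = u then a2 / a1 else if k = z1 then c3 / c2
          else if k = z2 then - (c1 * a2 / (a1 * c2)) else 0"]) (simp add: V adj b)
    qed (simp add: V)
    then show "matrix_rank (adjacency_matrix G vs) = 4" using d by simp
  qed
qed

text \<open>The disjoint edges \<open>x1 x2\<close> and \<open>z1 z2\<close> form a nonsingular
  block of size 4. Its Schur complement on \<open>u\<close> and \<open>v\<close> has zero diagonal
  and off-diagonal entry \<open>b - a1 * a3 / a2 - c1 * c3 / c2\<close>, so the rank is 4 if this
  entry vanishes and 6 otherwise.\<close>

lemma theta_202_rank:
  assumes d: "distinct [u, v, x1, x2, z1, z2]" and V: "verts G = {u, v, x1, x2, z1, z2}"
    and E: "edges G = {{u, x1}, {x1, x2}, {x2, v}, {u, v}, {u, z1}, {z1, z2}, {z2, v}}"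
  shows "matrix_rank (adjacency_matrix G vs) = 4 \<longleftrightarrow>
    weight G {x1, x2} * weight G {u, v} * weight G {z1, z2} -
    weight G {u, x1} * weight G {x2, v} * weight G {z1, z2} -
    weight G {x1, x2} * weight G {u, z1} * weight G {z2, v} = 0"
proof -
  have d': "distinct (rev [u, v, x1, x2, z1, z2])" unfolding distinct_rev by (rule d)
  define a1 a2 a3 b c1 c2 c3 where w: "a1 = weight G {u, x1}" "a2 = weight G {x1, x2}" "a3 = weight G {x2, v}"
    "b = weight G {u, v}" "c1 = weight G {u, z1}" "c2 = weight G {z1, z2}" "c3 = weight G {z2, v}"
  have pos: "a1 > 0" "a2 > 0" "a3 > 0" "b > 0" "c1 > 0" "c2 > 0" "c3 > 0"
    using G by (simp_all add: w weighted_graph_def E)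
  have e: "adj G u x1 = a1" "adj G x1 x2 = a2" "adj G x2 v = a3" "adj G u v = b" "adj G u z1 = c1"
    "adj G z1 z2 = c2" "adj G z2 v = c3"
    by (simp_all add: adj_def E w)
  have z: "adj G u u = 0" "adj G u x2 = 0" "adj G u z2 = 0" "adj G v v = 0" "adj G v x1 = 0"
    "adj G v z1 = 0" "adj G x1 x1 = 0" "adj G x1 z1 = 0" "adj G x1 z2 = 0" "adj G x2 x2 = 0"
    "adj G x2 z1 = 0" "adj G x2 z2 = 0" "adj G z1 z1 = 0" "adj G z2 z2 = 0"
    using d d' by (simp_all add: adj_def E doubleton_eq_iff)
  note adj = e e[THEN adj_sym] z z[THEN adj_sym]
  show ?thesis unfolding w(1-7)[symmetric]
  proof
    assume "matrix_rank (adjacency_matrix G vs) = 4"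
    then have "matrix_rank (adjacency_matrix G vs) < card {u, x1, x2, z1, z2}" using d by simp
    from adjacency_rank_less_imp_null_vector[OF vs _ this] V obtain f
      where f: "\<exists>k\<in>{u, x1, x2, z1, z2}. f k \<noteq> 0"
      and null: "\<forall>t\<in>verts G. (\<Sum>k\<in>{u, x1, x2, z1, z2}. adj G t k * f k) = 0" by blast
    have r: "a1 * f u + a2 * f x2 = 0" "c1 * f u + c2 * f z2 = 0" "b * f u + (a3 * f x2 + c3 * f z2) = 0"
        "f x1 = 0" "f z1 = 0"
      using null d d' pos by (simp_all add: V adj)
    \<comment> \<open>Row \<open>v\<close>, with \<open>f x2\<close> and \<open>f z2\<close>
      eliminated by means of rows \<open>x1\<close> and \<open>z1\<close>.\<close>
    have "f u * (a2 * b * c2 - a1 * a3 * c2 - a2 * c1 * c3) =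
        a2 * c2 * (b * f u + (a3 * f x2 + c3 * f z2)) - a3 * c2 * (a1 * f u + a2 * f x2)
        - a2 * c3 * (c1 * f u + c2 * f z2)"
      by (simp add: algebra_simps)
    then have "f u * (a2 * b * c2 - a1 * a3 * c2 - a2 * c1 * c3) = 0" unfolding r by simp
    moreover have "f u \<noteq> 0" using f r pos by auto
    ultimately show "a2 * b * c2 - a1 * a3 * c2 - a2 * c1 * c3 = 0" by simp
  next
    assume eq: "a2 * b * c2 - a1 * a3 * c2 - a2 * c1 * c3 = 0"
    have "a2 * c2 * (a3 * (a1 / a2) + c3 * (c1 / c2)) = a1 * a3 * c2 + a2 * c1 * c3"
      using pos by (simp add: distrib_left)
    also have "\<dots> = a2 * c2 * b" using eq by (simp add: algebra_simps)
    finally have b: "b = a3 * (a1 / a2) + c3 * (c1 / c2)" using pos by simp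
    have "matrix_rank (adjacency_matrix G vs) = card {x1, x2, z1, z2}"
    proof (rule adjacency_rank_eq_card[OF vs])
      fix f k assume "\<forall>t\<in>verts G. (\<Sum>k\<in>{x1, x2, z1, z2}. adj G t k * f k) = 0" and k: "k \<in> {x1, x2, z1, z2}"
      then have "f x1 = 0" "f x2 = 0" "f z1 = 0" "f z2 = 0"
        using d d' pos by (simp_all add: V adj)
      then show "f k = 0" using k by auto
    next
      fix t assume "t \<in> verts G" "t \<notin> {x1, x2, z1, z2}"
      then consider "t = u" | "t = v" using V by auto
      then show "\<exists>f. \<forall>s\<in>verts G. adj G s t = (\<Sum>k\<in>{x1, x2, z1, z2}. adj G s k * f k)"
      proof cases
        case 1
        show ?thesis using d d' pos 1 b
          by (intro exI[of _ "\<lambda>k. if k = x2 then a1 / a2 else if k = z2 then c1 / c2 else 0"])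
            (simp add: V adj)
      next
        case 2
        have "b = a1 * (a3 / a2) + c1 * (c3 / c2)" unfolding b by (simp add: mult.commute)
        then show ?thesis using d d' pos 2
          by (intro exI[of _ "\<lambda>k. if k = x1 then a3 / a2 else if k = z1 then c3 / c2 else 0"])
            (simp add: V adj)
      qed
    qed (simp add: V)
    then show "matrix_rank (adjacency_matrix G vs) = 4" using d by simp
  qed
qed

text \<open>If the products differ, the 4-cycle through the \<open>x\<close> vertices is
  nonsingular. The fifth vertex \<open>y2\<close> is chosen because it is adjacent to no vertex of
  that cycle and so leaves its equations untouched, while row \<open>y1\<close> ties it to
  \<open>v\<close> alone.\<close>

lemma infinity414_rank_4_imp:
  assumes d: "distinct [v, x1, x2, x3, y1, y2, y3]" and V: "verts G = {v, x1, x2, x3, y1, y2, y3}"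
    and E: "edges G = {{v, x1}, {x1, x2}, {x2, x3}, {x3, v}, {v, y1}, {y1, y2}, {y2, y3}, {y3, v}}"
    and rank: "matrix_rank (adjacency_matrix G vs) = 4"
  shows "weight G {v, x1} * weight G {x2, x3} = weight G {x1, x2} * weight G {x3, v}"
proof (rule ccontr)
  assume ne: "\<not> ?thesis"
  have d': "distinct (rev [v, x1, x2, x3, y1, y2, y3])" unfolding distinct_rev by (rule d)
  define a1 a2 a3 a4 b1 b2 where w: "a1 = weight G {v, x1}" "a2 = weight G {x1, x2}" "a3 = weight G {x2, x3}"
    "a4 = weight G {x3, v}" "b1 = weight G {v, y1}" "b2 = weight G {y1, y2}"
  have pos: "b2 > 0" using G by (simp_all add: w weighted_graph_def E)
  have e: "adj G v x1 = a1" "adj G x1 x2 = a2" "adj G x2 x3 = a3" "adj G x3 v = a4"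
    "adj G v y1 = b1" "adj G y1 y2 = b2"
    by (simp_all add: adj_def E w)
  have z: "adj G v v = 0" "adj G v x2 = 0" "adj G v y2 = 0" "adj G x1 x1 = 0" "adj G x1 x3 = 0"
    "adj G x1 y1 = 0" "adj G x1 y2 = 0" "adj G x1 y3 = 0" "adj G x2 x2 = 0" "adj G x2 y1 = 0"
    "adj G x2 y2 = 0" "adj G x2 y3 = 0" "adj G x3 x3 = 0" "adj G x3 y1 = 0" "adj G x3 y2 = 0"
    "adj G x3 y3 = 0" "adj G y1 y1 = 0" "adj G y1 y3 = 0" "adj G y2 y2 = 0" "adj G y3 y3 = 0"
    using d d' by (simp_all add: adj_def E doubleton_eq_iff)
  note adj = e e[THEN adj_sym] z z[THEN adj_sym]
  have "matrix_rank (adjacency_matrix G vs) < card {v, x1, x2, x3, y2}" using d rank by simp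
  from adjacency_rank_less_imp_null_vector[OF vs _ this] V obtain f
    where f: "\<exists>k\<in>{v, x1, x2, x3, y2}. f k \<noteq> 0"
    and null: "\<forall>t\<in>verts G. (\<Sum>k\<in>{v, x1, x2, x3, y2}. adj G t k * f k) = 0" by blast
  have r: "a1 * f v + a2 * f x2 = 0" "a4 * f v + a3 * f x2 = 0" "b1 * f v + b2 * f y2 = 0"
      "a1 * f x1 + a4 * f x3 = 0" "a2 * f x1 + a3 * f x3 = 0"
    using null d d' by (simp_all add: V adj)
  have ne': "a1 * a3 \<noteq> a2 * a4" "a1 * a3 \<noteq> a4 * a2" using ne by (simp_all add: w mult.commute)
  have "f v = 0" "f x2 = 0" "f x1 = 0" "f x3 = 0"
    using cramer_2[OF r(1,2) ne'(1)] cramer_2[OF r(4,5) ne'(2)] by simp_all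
  moreover from this have "f y2 = 0" using r(3) pos by simp
  ultimately show False using f by auto
qed

text \<open>Exchanging the cycles gives the second equation. Conversely, the equations make columns
  \<open>x3\<close> and \<open>y3\<close> multiples of columns \<open>x1\<close> and
  \<open>y1\<close>, and column \<open>v\<close> a combination of columns \<open>x2\<close> and
  \<open>y2\<close>.\<close>

lemma infinity414_rank:
  assumes d: "distinct [v, x1, x2, x3, y1, y2, y3]" and V: "verts G = {v, x1, x2, x3, y1, y2, y3}"
    and E: "edges G = {{v, x1}, {x1, x2}, {x2, x3}, {x3, v}, {v, y1}, {y1, y2}, {y2, y3}, {y3, v}}"
  shows "matrix_rank (adjacency_matrix G vs) = 4 \<longleftrightarrow>
    weight G {v, x1} * weight G {x2, x3} = weight G {x1, x2} * weight G {x3, v} \<and>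
    weight G {v, y1} * weight G {y2, y3} = weight G {y1, y2} * weight G {y3, v}" (is "?L \<longleftrightarrow> ?R")
proof
  assume rank: ?L
  have d': "distinct [v, y1, y2, y3, x1, x2, x3]" using d by auto
  have V': "verts G = {v, y1, y2, y3, x1, x2, x3}" unfolding V by (intro equalityI) simp_all
  have E': "edges G = {{v, y1}, {y1, y2}, {y2, y3}, {y3, v}, {v, x1}, {x1, x2}, {x2, x3}, {x3, v}}"
    unfolding E by (intro equalityI) simp_all
  show ?R
    using infinity414_rank_4_imp[OF d V E rank] infinity414_rank_4_imp[OF d' V' E' rank] by (rule conjI)
next
  assume ?R
  have d': "distinct (rev [v, x1, x2, x3, y1, y2, y3])" unfolding distinct_rev by (rule d)
  define a1 a2 a3 a4 b1 b2 b3 b4 where w: "a1 = weight G {v, x1}" "a2 = weight G {x1, x2}" "a3 = weight G {x2, x3}"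
    "a4 = weight G {x3, v}" "b1 = weight G {v, y1}" "b2 = weight G {y1, y2}" "b3 = weight G {y2, y3}" "b4 = weight G {y3, v}"
  have pos: "a1 > 0" "a2 > 0" "a3 > 0" "a4 > 0" "b1 > 0" "b2 > 0" "b3 > 0" "b4 > 0"
    using G by (simp_all add: w weighted_graph_def E)
  have "a1 * a3 = a2 * a4" "b1 * b3 = b2 * b4" using \<open>?R\<close> unfolding w by simp_all
  then have eq: "a4 = a1 * (a3 / a2)" "b4 = b1 * (b3 / b2)" using pos by simp_all
  have e: "adj G v x1 = a1" "adj G x1 x2 = a2" "adj G x2 x3 = a3" "adj G x3 v = a4"
    "adj G v y1 = b1" "adj G y1 y2 = b2" "adj G y2 y3 = b3" "adj G y3 v = b4"
    by (simp_all add: adj_def E w)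
  have z: "adj G v v = 0" "adj G v x2 = 0" "adj G v y2 = 0" "adj G x1 x1 = 0" "adj G x1 x3 = 0"
    "adj G x1 y1 = 0" "adj G x1 y2 = 0" "adj G x1 y3 = 0" "adj G x2 x2 = 0" "adj G x2 y1 = 0"
    "adj G x2 y2 = 0" "adj G x2 y3 = 0" "adj G x3 x3 = 0" "adj G x3 y1 = 0" "adj G x3 y2 = 0"
    "adj G x3 y3 = 0" "adj G y1 y1 = 0" "adj G y1 y3 = 0" "adj G y2 y2 = 0" "adj G y3 y3 = 0"
    using d d' by (simp_all add: adj_def E doubleton_eq_iff)
  note adj = e e[THEN adj_sym] z z[THEN adj_sym]
  have "matrix_rank (adjacency_matrix G vs) = card {x1, x2, y1, y2}"
  proof (rule adjacency_rank_eq_card[OF vs])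
    fix f k assume "\<forall>t\<in>verts G. (\<Sum>k\<in>{x1, x2, y1, y2}. adj G t k * f k) = 0" and k: "k \<in> {x1, x2, y1, y2}"
    then have "f x1 = 0" "f x2 = 0" "f y1 = 0" "f y2 = 0"
      using d d' pos by (simp_all add: V adj)
    then show "f k = 0" using k by auto
  next
    fix t assume "t \<in> verts G" "t \<notin> {x1, x2, y1, y2}"
    then consider "t = v" | "t = x3" | "t = y3" using V by auto
    then show "\<exists>f. \<forall>s\<in>verts G. adj G s t = (\<Sum>k\<in>{x1, x2, y1, y2}. adj G s k * f k)"
    proof cases
      case 1
      then show ?thesis using d d' pos
        by (intro exI[of _ "\<lambda>k. if k = x2 then a1 / a2 else if k = y2 then b1 / b2 else 0"])
          (simp add: V adj eq)
    next
      case 2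
      then show ?thesis using d d' pos
        by (intro exI[of _ "\<lambda>k. if k = x1 then a3 / a2 else 0"]) (simp add: V adj eq)
    next
      case 3
      then show ?thesis using d d' pos
        by (intro exI[of _ "\<lambda>k. if k = y1 then b3 / b2 else 0"]) (simp add: V adj eq)
    qed
  qed (simp add: V)
  then show ?L using d by simp
qed

end

section \<open>Classification\<close>

lemma card_eq_2_other:
  assumes "card A = 2" "a \<in> A"
  obtains b where "A = {a, b}" "a \<noteq> b"
proof -
  have "card (A - {a}) = 1" using assms by (simp add: card_Diff_singleton)
  then obtain b where "A - {a} = {b}" by (rule card_1_singletonE)
  then have "A = {a, b}" "a \<noteq> b" using assms(2) by auto
  then show thesis by (rule that)
qed

lemma card_eq_3_others:
  assumes "card A = 3" "a \<in> A"
  obtains b c where "A = {a, b, c}" "distinct [a, b, c]"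
proof -
  have "card (A - {a}) = 2" using assms by (simp add: card_Diff_singleton)
  then obtain b c where "A - {a} = {b, c}" "b \<noteq> c" by (meson card_2_iff)
  then have "A = {a, b, c}" "distinct [a, b, c]" using assms(2) by auto
  then show thesis using that[of b c] by blast
qed

text \<open>Meant for the excess of each degree over 2: the two units of excess sit at one vertex or
  at two.\<close>

lemma sum_eq_2_cases:
  fixes f :: "'a \<Rightarrow> nat"
  assumes fin: "finite A" and s: "sum f A = 2"
  obtains a where "a \<in> A" "f a = 2" "\<And>x. x \<in> A \<Longrightarrow> x \<noteq> a \<Longrightarrow> f x = 0"
  | a b where "a \<in> A" "b \<in> A" "a \<noteq> b" "f a = 1" "f b = 1"
      "\<And>x. x \<in> A \<Longrightarrow> x \<noteq> a \<Longrightarrow> x \<noteq> b \<Longrightarrow> f x = 0"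
proof -
  obtain a where a: "a \<in> A" "f a \<noteq> 0" using s by (metis sum.neutral zero_neq_numeral)
  have eq: "f a + sum f (A - {a}) = 2" using sum.remove[OF fin a(1), of f] s by simp
  show thesis
  proof (cases "f a = 2")
    case True
    then have "sum f (A - {a}) = 0" using eq by simp
    then have "\<And>x. x \<in> A \<Longrightarrow> x \<noteq> a \<Longrightarrow> f x = 0" using fin by simp
    then show ?thesis using that(1)[OF a(1) True] by simp
  next
    case False
    then have fa: "f a = 1" and "sum f (A - {a}) = 1" using eq a(2) by linarith+
    then obtain b where b: "b \<in> A - {a}" "f b = 1" "\<forall>x\<in>A - {a}. b \<noteq> x \<longrightarrow> f x = 0"
      using sum_eq_1_iff[of "A - {a}" f] fin by blast
    show ?thesis by (rule that(2)[of a b]) (use a(1) fa b in auto)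
  qed
qed

lemma card_2_pigeonhole: "card A = 2 \<Longrightarrow> a \<in> A \<Longrightarrow> b \<in> A \<Longrightarrow> c \<in> A \<Longrightarrow> a = b \<or> a = c \<or> b = c"
  by (auto simp: card_2_iff)

lemma card_eq_4_others:
  assumes "card A = 4" "a \<in> A" "b \<in> A" "a \<noteq> b"
  obtains c d where "A = {a, b, c, d}" "distinct [a, b, c, d]"
proof -
  have "card (A - {a}) = 3" "b \<in> A - {a}" using assms by (auto simp: card_Diff_singleton)
  then obtain c d where cd: "A - {a} = {b, c, d}" "distinct [b, c, d]" by (rule card_eq_3_others)
  then have "a \<notin> {b, c, d}" by blast
  then have "A = {a, b, c, d}" "distinct [a, b, c, d]" using cd assms(2) by auto
  then show thesis by (rule that)
qed

lemma card_eq_3_other: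
  assumes "card A = 3" "a \<in> A" "b \<in> A" "a \<noteq> b"
  obtains c where "A = {a, b, c}" "distinct [a, b, c]"
proof -
  have "card (A - {a}) = 2" "b \<in> A - {a}" using assms by (auto simp: card_Diff_singleton)
  then obtain c where c: "A - {a} = {b, c}" "b \<noteq> c" by (rule card_eq_2_other)
  then have "a \<notin> {b, c}" by blast
  then have "A = {a, b, c}" "distinct [a, b, c]" using c assms(2) by auto
  then show thesis by (rule that)
qed

lemma card_eq_2_pair: "card A = 2 \<Longrightarrow> a \<in> A \<Longrightarrow> b \<in> A \<Longrightarrow> a \<noteq> b \<Longrightarrow> A = {a, b}"
  by (auto simp: card_2_iff)

text \<open>Only the sign pattern of a null vector is retained: as the weights are positive, a row of
  the equation \<open>A x = 0\<close> forces the entries of \<open>x\<close> at the neighbours of a vertex to vanish or to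
  have both signs.\<close>

locale rank_four_graph =
  fixes V :: "'a set" and N :: "'a \<Rightarrow> 'a set"
  assumes N_sym: "y \<in> N x \<Longrightarrow> x \<in> N y"
    and N_irrefl: "x \<notin> N x"
    and N_V: "y \<in> N x \<Longrightarrow> y \<in> V"
    and null_vector: "distinct [a, b, c, d, e] \<Longrightarrow> {a, b, c, d, e} \<subseteq> V \<Longrightarrow>
      \<exists>x::'a \<Rightarrow> real. (x a \<noteq> 0 \<or> x b \<noteq> 0 \<or> x c \<noteq> 0 \<or> x d \<noteq> 0 \<or> x e \<noteq> 0) \<and>
        (\<forall>z. (\<forall>y\<in>N z \<inter> {a, b, c, d, e}. x y = 0) \<or>
          (\<exists>y\<in>N z \<inter> {a, b, c, d, e}. x y > 0) \<and> (\<exists>y\<in>N z \<inter> {a, b, c, d, e}. x y < 0))"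
begin

lemma N_iff: "y \<in> N x \<longleftrightarrow> x \<in> N y" using N_sym by blast

lemma N_V': "x \<in> N y \<Longrightarrow> y \<in> V" using N_V N_sym by blast

text \<open>The function is replaced by five separate real variables and each row by a propositional
  condition on their signs. Once the neighbourhoods are rewritten, every exclusion below is a small
  arithmetic problem for \<open>smt\<close>.\<close>

lemma nonzero_null_vector_contra:
  assumes "distinct [a, b, c, d, e]" "{a, b, c, d, e} \<subseteq> V"
    and zero: "\<And>(xa::real) (xb::real) (xc::real) (xd::real) (xe::real).
      \<forall>z. ((a \<in> N z \<longrightarrow> xa = 0) \<and> (b \<in> N z \<longrightarrow> xb = 0) \<and> (c \<in> N z \<longrightarrow> xc = 0)
          \<and> (d \<in> N z \<longrightarrow> xd = 0) \<and> (e \<in> N z \<longrightarrow> xe = 0)) \<or>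
        (a \<in> N z \<and> xa > 0 \<or> b \<in> N z \<and> xb > 0 \<or> c \<in> N z \<and> xc > 0
          \<or> d \<in> N z \<and> xd > 0 \<or> e \<in> N z \<and> xe > 0) \<and>
        (a \<in> N z \<and> xa < 0 \<or> b \<in> N z \<and> xb < 0 \<or> c \<in> N z \<and> xc < 0
          \<or> d \<in> N z \<and> xd < 0 \<or> e \<in> N z \<and> xe < 0) \<Longrightarrow>
      xa = 0 \<and> xb = 0 \<and> xc = 0 \<and> xd = 0 \<and> xe = 0"
  shows False
proof -
  from null_vector[OF assms(1,2)] obtain x :: "'a \<Rightarrow> real"
    where nz: "x a \<noteq> 0 \<or> x b \<noteq> 0 \<or> x c \<noteq> 0 \<or> x d \<noteq> 0 \<or> x e \<noteq> 0"
    and row: "\<And>z. (\<forall>y\<in>N z \<inter> {a, b, c, d, e}. x y = 0) \<or>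
          (\<exists>y\<in>N z \<inter> {a, b, c, d, e}. x y > 0) \<and> (\<exists>y\<in>N z \<inter> {a, b, c, d, e}. x y < 0)"
    by blast
  have "x a = 0 \<and> x b = 0 \<and> x c = 0 \<and> x d = 0 \<and> x e = 0"
  proof (intro zero allI, goal_cases)
    case (1 z)
    show ?case using row[of z] by (elim disjE conjE bexE) auto
  qed
  with nz show False by blast
qed

text \<open>Each of the following configurations is excluded by five vertices on which every null vector
  must vanish.\<close>

lemma no_pentagon:
  assumes d: "distinct [a, b, c, d, e]"
    and adj: "b \<in> N a" "c \<in> N b" "d \<in> N c" "e \<in> N d" "a \<in> N e"
    and nadj: "c \<notin> N a" "d \<notin> N a" "d \<notin> N b" "e \<notin> N b" "e \<notin> N c"
  shows False
proof -
  have V: "{a, b, c, d, e} \<subseteq> V" using adj N_V by blast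
  have sym: "a \<notin> N c" "a \<notin> N d" "b \<notin> N d" "b \<notin> N e" "c \<notin> N e"
    using nadj N_sym by blast+
  show False
  proof (rule nonzero_null_vector_contra[OF d V], goal_cases)
    case (1 xa xb xc xd xe)
    note row = spec[OF 1]
    \<comment> \<open>Each row says that its two neighbours on the pentagon vanish or have opposite
      signs. These pairs link the five entries in a closed chain of odd length, along which signs
      cannot alternate.\<close>
    from row[of a] row[of b] row[of c] row[of d] row[of e] show ?case
      by (simp add: adj nadj sym adj[THEN N_sym] N_irrefl) (smt (verit))
  qed
qed

text \<open>Rows \<open>p1\<close> and \<open>p2\<close> give these entries a common sign opposite
  to that of \<open>v\<close>. Row \<open>s\<close> makes \<open>p3\<close> vanish or, if
  \<open>s = p4\<close>, rows \<open>s\<close> and \<open>p3\<close> give \<open>p3\<close> and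
  \<open>s\<close> the sign opposite to \<open>v\<close> too. Row \<open>v\<close> then contains
  entries of one sign only.\<close>

lemma no_triangle_at_degree_4:
  assumes d: "distinct [p1, p2, p3, p4]" and Nv: "N v = {p1, p2, p3, p4}"
    and N1: "N p1 = {v, p2}" and N2: "N p2 = {v, p1}" and N3: "N p3 = {v, s}" and "s \<noteq> v"
  shows False
proof -
  have v: "v \<noteq> p1" "v \<noteq> p2" "v \<noteq> p3" "v \<noteq> p4" using N_irrefl[of v] Nv by auto
  have i: "\<And>z. p1 \<in> N z \<longleftrightarrow> z = v \<or> z = p2" "\<And>z. p2 \<in> N z \<longleftrightarrow> z = v \<or> z = p1"
    "\<And>z. p3 \<in> N z \<longleftrightarrow> z = v \<or> z = s" "\<And>z. v \<in> N z \<longleftrightarrow> z = p1 \<or> z = p2 \<or> z = p3 \<or> z = p4"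
    using N1 N2 N3 Nv N_iff by auto
  have "p3 \<notin> N p1" "p3 \<notin> N p2" "p3 \<notin> N p3" "p3 \<in> N s"
    using N1 N2 N_irrefl i(3)[of s] d v by auto
  then have s: "s \<noteq> p1" "s \<noteq> p2" "s \<noteq> p3" by auto
  have d5: "distinct [v, p1, p2, p3, s]" using d s v \<open>s \<noteq> v\<close> by auto
  have V: "{v, p1, p2, p3, s} \<subseteq> V" using N_V N_V' N1 N3 Nv by blast
  show False
  proof (rule nonzero_null_vector_contra[OF d5 V], goal_cases)
    case (1 xv x1 x2 x3 xs)
    note row = spec[OF 1]
    from row[of p1] row[of p2] row[of p3] row[of s] row[of v] show ?case
      using d s v \<open>s \<noteq> v\<close> by (simp add: i N1 N2 N3 Nv N_irrefl) (smt (verit))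
  qed
qed

text \<open>Zeros propagate: row \<open>r\<close> sees only \<open>q\<close>, then row
  \<open>p\<close> gives \<open>v\<close>, row \<open>p'\<close> gives \<open>q'\<close>, row
  \<open>q\<close> gives \<open>p\<close> and row \<open>v\<close> gives \<open>p'\<close>.\<close>

lemma no_path_at_degree_4:
  assumes d: "distinct [v, p, q, p', q']" and r: "q \<noteq> r" "r \<noteq> p" "r \<notin> N v"
    and v: "p \<in> N v" "p' \<in> N v" "q \<notin> N v" "q' \<notin> N v"
    and N: "N p = {v, q}" "N p' = {v, q'}" "N q = {p, r}" and "r \<notin> N q'" "r \<noteq> q'"
  shows False
proof -
  have i: "\<And>z. p \<in> N z \<longleftrightarrow> z = v \<or> z = q" "\<And>z. p' \<in> N z \<longleftrightarrow> z = v \<or> z = q'"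
    "\<And>z. q \<in> N z \<longleftrightarrow> z = p \<or> z = r"
    using N N_iff by auto
  have j: "v \<notin> N q" "v \<notin> N q'" "v \<notin> N r" "q' \<notin> N r" "q' \<notin> N q" "q' \<notin> N v" "p' \<noteq> r"
    using assms N_sym by auto
  have rv: "r \<noteq> v" using i(3)[of r] v by auto
  have V: "{v, p, q, p', q'} \<subseteq> V" using N_V N_V' N v by blast
  show False
  proof (rule nonzero_null_vector_contra[OF d V], goal_cases)
    case (1 xv x1 x2 x3 xs)
    note row = spec[OF 1]
    from row[of r] row[of p] row[of q] row[of p'] row[of v] show ?case
      using d r v rv \<open>r \<noteq> q'\<close> by (simp add: i j N N_irrefl) (smt (verit))
  qed
qed

text \<open>Rows \<open>x\<close> and \<open>p\<close> give \<open>v\<close> and \<open>s\<close>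
  the same sign, opposite to \<open>u\<close>. Row \<open>r\<close> sees \<open>v\<close>, possibly
  \<open>s\<close> and nothing else, so these and \<open>u\<close> vanish; rows \<open>v\<close> and
  \<open>u\<close> then dispose of \<open>x\<close> and \<open>p\<close>.\<close>

lemma no_common_neighbour:
  assumes "u \<noteq> v" and Nx: "N x = {u, v}" and Np: "N p = {u, s}" and "s \<noteq> u" "p \<noteq> v" "p \<notin> N v"
    and "r \<in> N v" "r \<notin> N u" "r \<noteq> u" "r \<notin> N p"
  shows False
proof -
  have i: "\<And>z. x \<in> N z \<longleftrightarrow> z = u \<or> z = v" "\<And>z. p \<in> N z \<longleftrightarrow> z = u \<or> z = s"
    using Nx Np N_iff by auto
  have sv: "s \<noteq> v" using i(2)[of v] \<open>p \<notin> N v\<close> by auto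
  have px: "p \<noteq> x" using i(1)[of v] \<open>p \<notin> N v\<close> by auto
  have pu: "p \<noteq> u" "p \<noteq> s" using N_irrefl[of p] Np by auto
  have xuv: "x \<noteq> u" "x \<noteq> v" using N_irrefl[of x] Nx by auto
  have sx: "s \<noteq> x" using Nx i(2)[of x] i(2)[of s] pu \<open>p \<noteq> v\<close> by auto
  have m: "p \<notin> N r" "u \<notin> N r" "v \<in> N r" "r \<noteq> v" "u \<in> N v \<longleftrightarrow> v \<in> N u"
    using assms N_sym N_irrefl by blast+
  have d: "distinct [u, v, x, p, s]"
    using \<open>u \<noteq> v\<close> \<open>s \<noteq> u\<close> \<open>p \<noteq> v\<close> sv px pu xuv sx by auto
  have V: "{u, v, x, p, s} \<subseteq> V" using N_V N_V' Nx Np by blast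
  have rx: "r \<noteq> s" using Np \<open>r \<notin> N p\<close> by auto
  show False
  proof (rule nonzero_null_vector_contra[OF d V], goal_cases)
    case (1 xu xv xx xp xs)
    note row = spec[OF 1]
    from row[of x] row[of p] row[of r] row[of v] row[of u] show ?case
      using d rx m assms by (simp add: i Nx Np N_irrefl) (smt (verit))
  qed
qed

text \<open>Row \<open>r\<close> sees only \<open>v\<close>, whose entry is therefore zero. Rows
  \<open>p1\<close> and \<open>p2\<close> give these two entries the same sign, so row
  \<open>u\<close> annihilates both; \<open>u\<close> and \<open>r\<close> follow from rows
  \<open>p1\<close> and \<open>v\<close>.\<close>

lemma no_triangle_at_bridge:
  assumes "u \<noteq> v" and Nu: "N u = {v, p1, p2}" and N1: "N p1 = {u, p2}" and N2: "N p2 = {u, p1}"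
    and d0: "distinct [v, p1, p2]"
    and r: "r \<in> N v" "r \<notin> N u" "r \<noteq> u"
  shows False
proof -
  have u: "u \<noteq> p1" "u \<noteq> p2" using N_irrefl[of u] Nu by auto
  have i: "\<And>z. p1 \<in> N z \<longleftrightarrow> z = u \<or> z = p2" "\<And>z. p2 \<in> N z \<longleftrightarrow> z = u \<or> z = p1"
    "\<And>z. u \<in> N z \<longleftrightarrow> z = v \<or> z = p1 \<or> z = p2"
    using Nu N1 N2 N_iff by auto
  have m: "v \<in> N r" "r \<noteq> v" "r \<noteq> p1" "r \<noteq> p2" using r N_sym N_irrefl Nu by blast+
  have d: "distinct [u, p1, p2, v, r]" using d0 u m r \<open>u \<noteq> v\<close> by auto
  have V: "{u, p1, p2, v, r} \<subseteq> V" using N_V N_V' Nu r by blast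
  show False
  proof (rule nonzero_null_vector_contra[OF d V], goal_cases)
    case (1 xu x1 x2 xv xr)
    note row = spec[OF 1]
    from row[of p1] row[of p2] row[of r] row[of v] row[of u] show ?case
      using d m r by (simp add: i N1 N2 Nu N_irrefl) (smt (verit))
  qed
qed

text \<open>Rows \<open>s\<close> and \<open>r\<close> annihilate \<open>p1\<close> and
  \<open>v\<close>. Rows \<open>p1\<close> and \<open>v\<close> then make \<open>s\<close> and
  \<open>r\<close> both opposite in sign to \<open>u\<close>, while row \<open>t\<close> sees
  \<open>r\<close> and, besides zero entries, at most \<open>s\<close>; hence all three
  vanish.\<close>

lemma no_path_at_bridge:
  assumes "u \<noteq> v" and Nu: "N u = {v, p1, p2}" and d0: "distinct [v, p1, p2]"
    and N1: "N p1 = {u, s}" and s: "s \<noteq> u" "s \<noteq> p2" "s \<noteq> v" "s \<notin> N v"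
    and Ns: "s \<notin> N r" and r: "r \<in> N v" "r \<notin> N u" "r \<noteq> u" "N r = {v, t}" "p2 \<notin> N r" "t \<noteq> v"
  shows False
proof -
  have u: "u \<noteq> p1" "u \<noteq> p2" using N_irrefl[of u] Nu by auto
  have i: "\<And>z. p1 \<in> N z \<longleftrightarrow> z = u \<or> z = s" "\<And>z. r \<in> N z \<longleftrightarrow> z = v \<or> z = t"
    "\<And>z. u \<in> N z \<longleftrightarrow> z = v \<or> z = p1 \<or> z = p2"
    using Nu N1 r N_iff by auto
  have s1: "s \<noteq> p1" using N_irrefl[of p1] N1 by auto
  have rs: "r \<noteq> v" "r \<noteq> p1" "r \<noteq> p2" "r \<noteq> s" using r N_irrefl[of v] Nu s by auto
  have p1r: "p1 \<notin> N r" using i(1)[of r] r rs by auto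
  have m: "v \<notin> N s" "r \<notin> N s" "v \<notin> N p1" "t \<noteq> p1" "t \<noteq> p2" "t \<noteq> s" "r \<notin> N p1"
    using s Ns r p1r N_sym N1 d0 u \<open>u \<noteq> v\<close> rs by auto
  have tu: "t \<noteq> u" "r \<noteq> t" using r i(2)[of u] N_irrefl[of r] by auto
  have d: "distinct [s, p1, u, v, r]" using d0 u m r s s1 rs \<open>u \<noteq> v\<close> by auto
  have V: "{s, p1, u, v, r} \<subseteq> V" using N_V N_V' Nu N1 r by blast
  show False
  proof (rule nonzero_null_vector_contra[OF d V], goal_cases)
    case (1 xs x1 xu xv xr)
    note row = spec[OF 1]
    from row[of s] row[of r] row[of p1] row[of v] row[of t] show ?case
      using d d0 m r s s1 rs p1r tu u by (simp add: i N1 Nu N_irrefl) (smt (verit))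
  qed
qed

text \<open>The vertex \<open>s\<close> cannot be a neighbour of \<open>u\<close>, so row
  \<open>s\<close> annihilates \<open>p3\<close>. Row \<open>u\<close> is left with the equally
  signed entries at \<open>p1\<close> and \<open>p2\<close>.\<close>

lemma no_triangle_at_degree_3:
  assumes d0: "distinct [p1, p2, p3]" and Nu: "N u = {p1, p2, p3}"
    and N1: "N p1 = {u, p2}" and N2: "N p2 = {u, p1}" and N3: "N p3 = {u, s}" and "s \<noteq> u"
  shows False
proof -
  have u: "u \<noteq> p1" "u \<noteq> p2" "u \<noteq> p3" using N_irrefl[of u] Nu by auto
  have i: "\<And>z. p1 \<in> N z \<longleftrightarrow> z = u \<or> z = p2" "\<And>z. p2 \<in> N z \<longleftrightarrow> z = u \<or> z = p1"
    "\<And>z. p3 \<in> N z \<longleftrightarrow> z = u \<or> z = s" "\<And>z. u \<in> N z \<longleftrightarrow> z = p1 \<or> z = p2 \<or> z = p3"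
    using N1 N2 N3 Nu N_iff by auto
  have "p3 \<notin> N p1" "p3 \<notin> N p2" "p3 \<notin> N p3" "p3 \<in> N s"
    using N1 N2 N_irrefl i(3)[of s] d0 u by auto
  then have s: "s \<noteq> p1" "s \<noteq> p2" "s \<noteq> p3" by auto
  have d5: "distinct [u, p1, p2, p3, s]" using d0 s u \<open>s \<noteq> u\<close> by auto
  have V: "{u, p1, p2, p3, s} \<subseteq> V" using N_V N_V' N1 N3 Nu by blast
  show False
  proof (rule nonzero_null_vector_contra[OF d5 V], goal_cases)
    case (1 xv x1 x2 x3 xs)
    note row = spec[OF 1]
    from row[of p1] row[of p2] row[of p3] row[of s] row[of u] show ?case
      using d0 s u \<open>s \<noteq> u\<close> by (simp add: i N1 N2 N3 Nu N_irrefl) (smt (verit))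
  qed
qed

text \<open>The outer vertices may be adjacent to each other, so only \<open>s1\<close> joins the
  support. Row \<open>s1\<close> annihilates \<open>p1\<close>, row \<open>p2\<close> annihilates
  \<open>u\<close>, row \<open>p1\<close> then gives \<open>s1\<close>, and rows \<open>s2\<close>
  and \<open>s3\<close> give \<open>p2\<close> and \<open>p3\<close>.\<close>

lemma no_spider:
  assumes d0: "distinct [p1, p2, p3]" and Nu: "N u = {p1, p2, p3}"
    and N: "N p1 = {u, s1}" "N p2 = {u, s2}" "N p3 = {u, s3}"
    and s: "distinct [s1, s2, s3]" "s1 \<noteq> u" "s1 \<notin> N u" "s2 \<noteq> u" "s2 \<notin> N u" "s3 \<noteq> u" "s3 \<notin> N u"
  shows False
proof -
  have u: "u \<noteq> p1" "u \<noteq> p2" "u \<noteq> p3" using N_irrefl[of u] Nu by auto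
  have i: "\<And>z. p1 \<in> N z \<longleftrightarrow> z = u \<or> z = s1" "\<And>z. p2 \<in> N z \<longleftrightarrow> z = u \<or> z = s2"
    "\<And>z. p3 \<in> N z \<longleftrightarrow> z = u \<or> z = s3" "\<And>z. u \<in> N z \<longleftrightarrow> z = p1 \<or> z = p2 \<or> z = p3"
    using N Nu N_iff by auto
  have sp: "s1 \<noteq> p1" "s1 \<noteq> p2" "s1 \<noteq> p3" "s2 \<noteq> p1" "s2 \<noteq> p2" "s2 \<noteq> p3" "s3 \<noteq> p1" "s3 \<noteq> p2" "s3 \<noteq> p3"
    using s Nu by auto
  have d5: "distinct [u, p1, p2, p3, s1]" using d0 s u sp by auto
  have V: "{u, p1, p2, p3, s1} \<subseteq> V" using N_V N_V' N Nu by blast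
  show False
  proof (rule nonzero_null_vector_contra[OF d5 V], goal_cases)
    case (1 xu x1 x2 x3 xs)
    note row = spec[OF 1]
    from row[of s1] row[of s2] row[of s3] row[of p1] row[of p2] show ?case
      using d0 s u sp by (simp add: i N Nu N_irrefl) (smt (verit))
  qed
qed

text \<open>With \<open>p2\<close> left out of the support, row \<open>s\<close> sees only
  \<open>p1\<close>; row \<open>u\<close> then gives \<open>p3\<close>, row \<open>t\<close> gives
  \<open>s'\<close>, and rows \<open>p3\<close> and \<open>p1\<close> give \<open>u\<close> and
  \<open>s\<close>.\<close>

lemma no_square_path:
  assumes d0: "distinct [p1, p2, p3]" and Nu: "N u = {p1, p2, p3}"
    and N: "N p1 = {u, s}" "N p2 = {u, s}" "N p3 = {u, s'}" "N s = {p1, p2}" "N s' = {p3, t}"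
    and s: "s \<noteq> s'" "s \<noteq> u" "s \<notin> N u" "s' \<noteq> u" "s' \<notin> N u" and "t \<noteq> p3"
  shows False
proof -
  have u: "u \<noteq> p1" "u \<noteq> p2" "u \<noteq> p3" using N_irrefl[of u] Nu by auto
  have i: "\<And>z. p1 \<in> N z \<longleftrightarrow> z = u \<or> z = s" "\<And>z. p2 \<in> N z \<longleftrightarrow> z = u \<or> z = s"
    "\<And>z. p3 \<in> N z \<longleftrightarrow> z = u \<or> z = s'" "\<And>z. u \<in> N z \<longleftrightarrow> z = p1 \<or> z = p2 \<or> z = p3"
    "\<And>z. s \<in> N z \<longleftrightarrow> z = p1 \<or> z = p2" "\<And>z. s' \<in> N z \<longleftrightarrow> z = p3 \<or> z = t"
    using N Nu N_iff by auto
  have sp: "s \<noteq> p1" "s \<noteq> p2" "s \<noteq> p3" "s' \<noteq> p1" "s' \<noteq> p2" "s' \<noteq> p3"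
    using s Nu by auto
  have "s' \<notin> N u" "s' \<notin> N p1" "s' \<notin> N p2" "s' \<notin> N s" "s' \<notin> N s'" "s' \<in> N t"
    using s sp N Nu N_irrefl i(6)[of t] by auto
  then have t: "t \<noteq> u" "t \<noteq> p1" "t \<noteq> p2" "t \<noteq> s" "t \<noteq> s'" by auto
  have d5: "distinct [s, p1, u, p3, s']" using d0 s u sp by auto
  have V: "{s, p1, u, p3, s'} \<subseteq> V" using N_V N_V' N Nu by blast
  show False
  proof (rule nonzero_null_vector_contra[OF d5 V], goal_cases)
    case (1 xs x1 xu x3 xs')
    note row = spec[OF 1]
    from row[of s] row[of u] row[of t] row[of p1] row[of p3] show ?case
      using d0 s u sp t \<open>t \<noteq> p3\<close> by (simp add: i N Nu N_irrefl) (smt (verit))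
  qed
qed

end

text \<open>Connectedness is stated as the absence of proper nonempty closed sets of vertices, the
  form that ends each case once the vertices found contain all their neighbourhoods. The degree sum
  is twice the number of edges.\<close>

locale rank_four_bicyclic_graph = rank_four_graph +
  assumes finite_V: "finite V"
    and connected: "S \<subseteq> V \<Longrightarrow> S \<noteq> {} \<Longrightarrow> (\<Union>x\<in>S. N x) \<subseteq> S \<Longrightarrow> V = S"
    and degree_ge_2: "x \<in> V \<Longrightarrow> card (N x) \<ge> 2"
    and degree_sum: "(\<Sum>x\<in>V. card (N x)) = 2 * card V + 2"
begin

section \<open>Shapes around the vertices of degree above two\<close>

lemma N_subset_V: "N x \<subseteq> V" using N_V by blast

text \<open>No two neighbours of \<open>v\<close> are adjacent, and each shares its second neighbour
  with another one. Two such pairs close two 4-cycles, and these already form a closed set.\<close>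

lemma degree_4_vertex:
  assumes v: "card (N v) = 4" and rest: "\<forall>x\<in>V - {v}. card (N x) = 2"
  shows "\<exists>p1 p2 p3 p4 q r. distinct [v, p1, p2, p3, p4, q, r] \<and> V = {v, p1, p2, p3, p4, q, r} \<and>
    N v = {p1, p2, p3, p4} \<and> N p1 = {v, q} \<and> N p2 = {v, q} \<and> N p3 = {v, r} \<and> N p4 = {v, r} \<and>
    N q = {p1, p2} \<and> N r = {p3, p4}"
proof -
  have two: "card (N x) = 2" if "x \<in> V" "x \<noteq> v" for x
    using rest that by blast
  have ex: "\<exists>q. N p = {v, q} \<and> v \<noteq> q" if "p \<in> N v" for p
  proof -
    have "card (N p) = 2" using two[of p] that N_V N_irrefl by blast
    moreover have "v \<in> N p" using that by (rule N_sym)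
    ultimately show ?thesis by (meson card_eq_2_other)
  qed
  have nadj: "p' \<notin> N p" if p: "p \<in> N v" "p' \<in> N v" for p p'
  proof
    assume a: "p' \<in> N p"
    then have "p \<noteq> p'" using N_irrefl by blast
    have "v \<noteq> p'" "v \<noteq> p" using p N_irrefl by blast+
    have N: "N p = {v, p'}" "N p' = {v, p}"
      using ex[OF p(1)] ex[OF p(2)] a N_sym[OF a] \<open>v \<noteq> p\<close> \<open>v \<noteq> p'\<close> by auto
    obtain p3 p4 where 34: "N v = {p, p', p3, p4}" "distinct [p, p', p3, p4]"
      using card_eq_4_others[OF v p \<open>p \<noteq> p'\<close>] .
    then obtain s where "N p3 = {v, s}" "v \<noteq> s" using ex[of p3] by auto
    with no_triangle_at_degree_4[OF 34(2,1) N] show False by blast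
  qed
  \<comment> \<open>Otherwise the path through \<open>p\<close> runs on to a vertex \<open>r\<close>
    not adjacent to \<open>v\<close>, and the second neighbour of every other neighbour of
    \<open>v\<close> must be adjacent to \<open>r\<close>. This crowds three neighbours onto a
    vertex of degree 2.\<close>
  have partner: "\<exists>p' q. p' \<in> N v \<and> p' \<noteq> p \<and> N p = {v, q} \<and> N p' = {v, q} \<and> N q = {p, p'}
      \<and> q \<noteq> v \<and> q \<notin> N v" if p: "p \<in> N v" for p
  proof -
    obtain q where q: "N p = {v, q}" "v \<noteq> q" using ex[OF p] by blast
    have pq: "q \<in> N p" "p \<in> N q" using q N_sym[of q p] by auto
    have qv: "q \<notin> N v" "v \<notin> N q" using nadj[OF p, of q] pq N_sym by blast+
    have "card (N q) = 2" using two[of q] q pq N_V by blast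
    then obtain r where r: "N q = {p, r}" "p \<noteq> r" using pq card_eq_2_other by metis
    have rq: "r \<in> N q" "q \<in> N r" using r N_sym[of r q] by auto
    have "r \<noteq> v" "q \<noteq> r" using rq qv N_irrefl by blast+
    show ?thesis
    proof (cases "r \<in> N v")
      case True
      then have "N r = {v, q}" using ex[of r] rq q by auto
      then show ?thesis using True r q qv by blast
    next
      case False
      \<comment> \<open>Without this adjacency, \<open>r = q'\<close> closes an induced pentagon,
        and \<open>r \<noteq> q'\<close> is the situation of
        \<open>no_path_at_degree_4\<close>.\<close>
      have *: "r \<in> N q'" if p': "p' \<in> N v" "p' \<noteq> p" and N': "N p' = {v, q'}" "v \<noteq> q'" for p' q'
      proof (rule ccontr)
        assume n: "r \<notin> N q'"
        have pq': "q' \<in> N p'" "p' \<in> N q'" using N' N_sym[of q' p'] by auto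
        have q'v: "q' \<notin> N v" using nadj[OF p'(1), of q'] pq' by blast
        have vp: "v \<noteq> p" "v \<noteq> p'" using p p' N_irrefl by blast+
        have "p' \<noteq> q" "p' \<noteq> q'" "p' \<noteq> r" "p \<noteq> q" "p \<noteq> q'"
          using p' p qv q'v False by blast+
        show False
        proof (cases "r = q'")
          case True
          have "distinct [v, p, q, r, p']"
            using vp q(2) \<open>r \<noteq> v\<close> p' \<open>p \<noteq> q\<close> r(2) \<open>q \<noteq> r\<close> \<open>p' \<noteq> q\<close> \<open>p' \<noteq> r\<close> by auto
          moreover have "p' \<notin> N q" using r p' \<open>p' \<noteq> r\<close> by simp
          moreover have "r \<notin> N p" using q \<open>q \<noteq> r\<close> \<open>r \<noteq> v\<close> by simp
          ultimately show False
            using no_pentagon[of v p q r p'] p pq rq True pq' N_sym[OF p'(1)] qv False nadj[OF p p'(1)]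
            by blast
        next
          case r': False
          have "p' \<notin> N q" using r p' \<open>p' \<noteq> r\<close> by simp
          then have "q \<noteq> q'" using pq' by blast
          then have "distinct [v, p, q, p', q']"
            using vp q(2) N'(2) p' \<open>p \<noteq> q\<close> \<open>p' \<noteq> q\<close> \<open>p' \<noteq> q'\<close> \<open>p \<noteq> q'\<close> by auto
          from no_path_at_degree_4[OF this \<open>q \<noteq> r\<close> _ False p p'(1) qv(1) q'v q(1) N'(1) r(1) n r'] r(2)
          show False by blast
        qed
      qed
      have "card (N v - {p}) = 3" using v p by (simp add: card_Diff_singleton)
      then have "N v - {p} \<noteq> {}" by (metis card.empty zero_neq_numeral)
      then obtain p' where "p' \<in> N v" "p' \<noteq> p" by blast
      from card_eq_4_others[OF v p this(1) this(2)[symmetric]] obtain p3 p4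
        where 34: "N v = {p, p', p3, p4}" "distinct [p, p', p3, p4]" .
      then have m: "p' \<in> N v" "p3 \<in> N v" "p' \<noteq> p" "p3 \<noteq> p" "p' \<noteq> p3" by auto
      obtain q' q3 where N': "N p' = {v, q'}" "v \<noteq> q'" "N p3 = {v, q3}" "v \<noteq> q3"
        using ex[OF m(1)] ex[OF m(2)] by blast
      have rr: "r \<in> N q'" "r \<in> N q3" using * m N' by blast+
      have "p' \<in> N q'" "p3 \<in> N q3" using N' N_sym[of q' p'] N_sym[of q3 p3] by auto
      have "q \<noteq> q'" "q \<noteq> q3" using r \<open>p' \<in> N q'\<close> \<open>p3 \<in> N q3\<close> m False by auto
      moreover have "card (N r) = 2" using two[of r] \<open>r \<noteq> v\<close> rq N_V by blast
      \<comment> \<open>Besides \<open>q\<close>, the vertex \<open>r\<close> has only one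
        neighbour, so \<open>p'\<close> and \<open>p3\<close> share it; together with
        \<open>r\<close> they would give it degree 3.\<close>
      ultimately have "q' = q3" using card_2_pigeonhole[of "N r" q q' q3] rq rr[THEN N_sym] by blast
      moreover have "card (N q') = 2" using two[of q'] N'(2) rr N_V' by blast
      ultimately show ?thesis
        using card_2_pigeonhole[of "N q'" p' p3 r] \<open>p' \<in> N q'\<close> \<open>p3 \<in> N q3\<close> rr m False by blast
    qed
  qed
  have "N v \<noteq> {}" using v by auto
  then obtain p1 where p1: "p1 \<in> N v" by blast
  from partner[OF this] obtain p2 q where p2: "p2 \<in> N v" "p2 \<noteq> p1"
    and q: "N p1 = {v, q}" "N p2 = {v, q}" "N q = {p1, p2}" "q \<noteq> v" "q \<notin> N v" by blast
  from card_eq_4_others[OF v p1 p2(1) p2(2)[symmetric]] obtain p3 p4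
    where 34: "N v = {p1, p2, p3, p4}" "distinct [p1, p2, p3, p4]" .
  from partner[of p3] 34 obtain p r where p: "p \<in> N v" "p \<noteq> p3"
    and r: "N p3 = {v, r}" "N p = {v, r}" "N r = {p3, p}" "r \<noteq> v" "r \<notin> N v" by auto
  have "p \<notin> {p1, p2}"
  proof
    assume "p \<in> {p1, p2}"
    then have "r = q" using q r by (auto simp: doubleton_eq_iff)
    then show False using q(3) r(3) 34(2) by (auto simp: doubleton_eq_iff)
  qed
  then have p4: "p = p4" using p 34 by auto
  have "r \<noteq> q" using q(3) r(3) 34(2) by (auto simp: doubleton_eq_iff)
  have vn: "v \<noteq> p1" "v \<noteq> p2" "v \<noteq> p3" "v \<noteq> p4" using N_irrefl[of v] 34(1) by simp_all
  have qn: "p1 \<noteq> q" "p2 \<noteq> q" "p3 \<noteq> q" "p4 \<noteq> q" using q(5) 34(1) by auto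
  have rn: "p1 \<noteq> r" "p2 \<noteq> r" "p3 \<noteq> r" "p4 \<noteq> r" using r(5) 34(1) by auto
  have d: "distinct [v, p1, p2, p3, p4, q, r]"
    using 34(2) q(4) r(4) vn qn rn \<open>r \<noteq> q\<close> by simp
  have "V = {v, p1, p2, p3, p4, q, r}"
  proof (rule connected)
    show "{v, p1, p2, p3, p4, q, r} \<subseteq> V"
      using N_subset_V[of v] N_subset_V[of p1] N_subset_V[of p3] by (simp add: 34(1) q(1) r(1))
    show "(\<Union>x\<in>{v, p1, p2, p3, p4, q, r}. N x) \<subseteq> {v, p1, p2, p3, p4, q, r}"
        by (simp add: 34(1) q(1-3) r(1,3) r(2)[unfolded p4] p4)
  qed simp
  note V = this
  have N4: "N p4 = {v, r}" "N r = {p3, p4}" using r(2,3) p4 by simp_all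
  show ?thesis
    by (rule exI[of _ p1], rule exI[of _ p2], rule exI[of _ p3], rule exI[of _ p4],
        rule exI[of _ q], rule exI[of _ r], intro conjI)
      (fact d V N4 34(1) q(1-3) r(1))+
qed

text \<open>One neighbour of \<open>u\<close> and one of \<open>v\<close> remain. If they coincide,
  the first shape arises; if they are adjacent, the second; otherwise
  \<open>no_common_neighbour\<close> applies.\<close>

lemma degree_3_adjacent_common:
  assumes uv: "v \<in> N u" and du: "card (N u) = 3" and dv: "card (N v) = 3"
    and rest: "\<forall>x\<in>V - {u, v}. card (N x) = 2"
    and x: "x \<in> N u" "x \<in> N v"
  shows "(\<exists>z. distinct [u, v, x, z] \<and> V = {u, v, x, z} \<and>
      N u = {x, v, z} \<and> N v = {x, u, z} \<and> N x = {u, v} \<and> N z = {u, v}) \<or>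
    (\<exists>z1 z2. distinct [u, v, x, z1, z2] \<and> V = {u, v, x, z1, z2} \<and>
      N u = {x, v, z1} \<and> N v = {x, u, z2} \<and> N x = {u, v} \<and> N z1 = {u, z2} \<and> N z2 = {z1, v})"
proof -
  have two: "card (N x) = 2" if "x \<in> V" "x \<noteq> u" "x \<noteq> v" for x
    using rest that by blast
  have ne: "u \<noteq> v" "x \<noteq> u" "x \<noteq> v" using uv x N_irrefl by blast+
  obtain p where p: "N u = {v, x, p}" "distinct [v, x, p]"
    using card_eq_3_other[OF du uv x(1)] ne by blast
  obtain r where r: "N v = {u, x, r}" "distinct [u, x, r]"
    using card_eq_3_other[OF dv N_sym[OF uv] x(2)] ne by blast
  have Nx: "N x = {u, v}"
    using card_eq_2_pair[of "N x" u v] two[of x] x N_V N_sym ne by blast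
  have pr: "p \<noteq> u" "r \<noteq> v" using p r N_irrefl by blast+
  have pr': "u \<in> N p" "v \<in> N r" using p r N_iff by auto
  have dp: "card (N p) = 2" "card (N r) = 2" using two[of p] two[of r] p r pr N_V by auto
  show ?thesis
  proof (cases "p = r")
    case True
    have Np: "N p = {u, v}" using card_eq_2_pair[OF dp(1) pr'(1)] pr'(2) True ne by blast
    have "V = {u, v, x, p}"
    proof (rule connected)
      show "{u, v, x, p} \<subseteq> V" using N_subset_V[of u] N_subset_V[of v] by (simp add: p(1) r(1))
      show "(\<Union>x\<in>{u, v, x, p}. N x) \<subseteq> {u, v, x, p}"
        by (simp add: p(1) r(1) True Nx Np[unfolded True])
    qed simp
    moreover have d: "distinct [u, v, x, p]" using p ne pr by auto
    moreover have p': "N u = {x, v, p}" and r': "N v = {x, u, p}" using p r True by auto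
    ultimately have "\<exists>z. distinct [u, v, x, z] \<and> V = {u, v, x, z} \<and>
      N u = {x, v, z} \<and> N v = {x, u, z} \<and> N x = {u, v} \<and> N z = {u, v}"
      using p' r' d Np Nx by blast
    then show ?thesis ..
  next
    case False
    have nv: "p \<notin> N v" "r \<notin> N u" using p r pr False by auto
    show ?thesis
    proof (cases "r \<in> N p")
      case rp: True
      have Np: "N p = {u, r}" using card_eq_2_pair[OF dp(1) pr'(1) rp] r by auto
      have Nr: "N r = {p, v}" using card_eq_2_pair[OF dp(2) N_sym[OF rp] pr'(2)] p by auto
      have "V = {u, v, x, p, r}"
      proof (rule connected)
        show "{u, v, x, p, r} \<subseteq> V" using N_subset_V[of u] N_subset_V[of v] by (simp add: p(1) r(1))
        show "(\<Union>x\<in>{u, v, x, p, r}. N x) \<subseteq> {u, v, x, p, r}"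
        by (simp add: p(1) r(1) Nx Np Nr)
      qed simp
      moreover have d: "distinct [u, v, x, p, r]" using p r False ne pr by auto
      moreover have p': "N u = {x, v, p}" and r': "N v = {x, u, r}" using p r by auto
      ultimately have "\<exists>z1 z2. distinct [u, v, x, z1, z2] \<and> V = {u, v, x, z1, z2} \<and>
        N u = {x, v, z1} \<and> N v = {x, u, z2} \<and> N x = {u, v} \<and> N z1 = {u, z2} \<and> N z2 = {z1, v}"
        using p' r' d Np Nr Nx by blast
      then show ?thesis ..
    next
      case rp: False
      obtain s where s: "N p = {u, s}" "u \<noteq> s" using card_eq_2_other[OF dp(1) pr'(1)] .
      have "False"
        using no_common_neighbour[OF ne(1) Nx s(1) s(2)[symmetric] _ nv(1) _ nv(2) _ rp] p r by auto
      then show ?thesis ..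
    qed
  qed
qed

text \<open>Each further neighbour of \<open>u\<close> is adjacent to a further neighbour of
  \<open>v\<close>. As these vertices have degree 2, this matches them in pairs and closes two
  4-cycles over the edge joining \<open>u\<close> and \<open>v\<close>.\<close>

lemma degree_3_adjacent_disjoint:
  assumes uv: "v \<in> N u" and du: "card (N u) = 3" and dv: "card (N v) = 3"
    and rest: "\<forall>x\<in>V - {u, v}. card (N x) = 2"
    and disj: "N u \<inter> N v = {}"
  shows "\<exists>x1 x2 z1 z2. distinct [u, v, x1, x2, z1, z2] \<and> V = {u, v, x1, x2, z1, z2} \<and>
      N u = {x1, v, z1} \<and> N v = {x2, u, z2} \<and> N x1 = {u, x2} \<and> N x2 = {x1, v} \<and>
      N z1 = {u, z2} \<and> N z2 = {z1, v}"
proof -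
  have two: "card (N x) = 2" if "x \<in> V" "x \<noteq> u" "x \<noteq> v" for x
    using rest that by blast
  have ne: "u \<noteq> v" using uv N_irrefl by blast
  \<comment> \<open>Otherwise the vertex \<open>s\<close> after \<open>p\<close> is not
    \<open>p'\<close>, by \<open>no_triangle_at_bridge\<close>, and is adjacent to neither
    \<open>r\<close> nor \<open>r'\<close>, by \<open>no_pentagon\<close>. As \<open>p'\<close> has
    degree 2 and \<open>u\<close> as a neighbour, it misses one of \<open>r\<close>,
    \<open>r'\<close>, and \<open>no_path_at_bridge\<close> applies to that one.\<close>
  have meet: "r \<in> N p \<or> r' \<in> N p"
    if Nu: "N u = {v, p, p'}" "distinct [v, p, p']" and Nv: "N v = {u, r, r'}" "distinct [u, r, r']"
    for p p' r r'
  proof (rule ccontr)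
    assume "\<not> ?thesis"
    then have n: "r \<notin> N p" "r' \<notin> N p" by auto
    have mem: "p \<in> N u" "p' \<in> N u" "r \<in> N v" "r' \<in> N v" using Nu Nv by simp_all
    then have pu: "p \<noteq> u" "p' \<noteq> u" "u \<in> N p" "u \<in> N p'"
      and pv: "p \<notin> N v" "p' \<notin> N v"
      and ru: "r \<notin> N u" "r' \<notin> N u" "r \<noteq> v" "r' \<noteq> v" "v \<in> N r" "v \<in> N r'"
      using disj N_irrefl[of u] N_irrefl[of v] N_sym[of _ u] N_sym[of _ v] by blast+
    have c2: "card (N p) = 2" "card (N p') = 2" "card (N r) = 2" "card (N r') = 2"
      using two[of p] two[of p'] two[of r] two[of r'] N_V'[OF pu(3)] N_V'[OF pu(4)]
        N_V'[OF ru(5)] N_V'[OF ru(6)] pu ru Nu(2) Nv(2) by auto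
    obtain s where s: "N p = {u, s}" "u \<noteq> s" using card_eq_2_other[OF c2(1) pu(3)] .
    have sp: "s \<in> N p" "p \<in> N s" using s N_sym[of s p] by auto
    have "s \<noteq> v" using sp pv by blast
    have "s \<noteq> p'"
    proof
      assume eq: "s = p'"
      have "p \<in> N p'" "u \<noteq> p" using sp(2) pu(1) eq by blast+
      from card_eq_2_pair[OF c2(2) pu(4) this] have "N p' = {u, p}" .
      from no_triangle_at_bridge[OF ne Nu(1) s(1)[unfolded eq] this Nu(2) mem(3) ru(1)] Nv(2)
      show False by auto
    qed
    have sv: "s \<notin> N v" using s(2) n sp(1) by (auto simp: Nv(1))
    have sr: "s \<notin> N r0" if "r0 \<in> {r, r'}" for r0
    proof
      assume "s \<in> N r0"
      have r0: "r0 \<notin> N u" "r0 \<notin> N p" "r0 \<noteq> u" "r0 \<noteq> v" "v \<in> N r0" using that ru n Nv(2) by auto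
      have "s \<noteq> p" using sp N_irrefl by blast
      have "s \<notin> N u" using \<open>s \<noteq> v\<close> \<open>s \<noteq> p'\<close> \<open>s \<noteq> p\<close> by (simp add: Nu(1))
      moreover have "distinct [u, p, s, r0, v]"
      proof -
        have "s \<noteq> r0" using \<open>s \<in> N r0\<close> N_irrefl by blast
        moreover have "p \<noteq> r0" using r0(1) mem(1) by blast
        ultimately show ?thesis
          using pu(1) s(2) r0(3,4) ne Nu(2) \<open>s \<noteq> v\<close> \<open>s \<noteq> p\<close> by auto
      qed
      moreover have "p \<in> N u" "r0 \<in> N s" using N_sym pu(3) \<open>s \<in> N r0\<close> by blast+
      moreover have "v \<notin> N p" "v \<notin> N s" using N_sym pv(1) sv by blast+
      ultimately show False
        using no_pentagon[of u p s r0 v] sp r0 N_sym[OF uv] by blast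
    qed
    have "\<not> (r \<in> N p' \<and> r' \<in> N p')"
      using card_2_pigeonhole[OF c2(2) _ _ pu(4), of r r'] Nv(2) by auto
    then obtain r0 where r0: "r0 \<in> {r, r'}" "p' \<notin> N r0" using N_sym by blast
    then have r0': "card (N r0) = 2" "v \<in> N r0" "r0 \<in> N v" "r0 \<notin> N u" "r0 \<noteq> u"
      using c2(3,4) ru mem(3,4) Nv(2) by auto
    obtain t where "N r0 = {v, t}" "v \<noteq> t" using card_eq_2_other[OF r0'(1,2)] .
    with no_path_at_bridge[OF ne Nu s(1) s(2)[symmetric] \<open>s \<noteq> p'\<close> \<open>s \<noteq> v\<close> sv sr[OF r0(1)] r0'(3-5) _ r0(2)]
    show False by blast
  qed
  obtain p1 p2 where p: "N u = {v, p1, p2}" "distinct [v, p1, p2]" using card_eq_3_others[OF du uv] .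
  obtain r1 r2 where r: "N v = {u, r1, r2}" "distinct [u, r1, r2]"
    using card_eq_3_others[OF dv N_sym[OF uv]] .
  have mem: "p1 \<in> N u" "p2 \<in> N u" "r1 \<in> N v" "r2 \<in> N v" using p r by simp_all
  then have pu: "p1 \<noteq> u" "p2 \<noteq> u" "u \<in> N p1" "u \<in> N p2"
    and ru: "r1 \<noteq> v" "r2 \<noteq> v" "v \<in> N r1" "v \<in> N r2"
    using N_irrefl[of u] N_irrefl[of v] N_sym[of _ u] N_sym[of _ v] by blast+
  have c2: "card (N p1) = 2" "card (N p2) = 2" "card (N r1) = 2" "card (N r2) = 2"
    using two[of p1] two[of p2] two[of r1] two[of r2] N_V'[OF pu(3)] N_V'[OF pu(4)]
      N_V'[OF ru(3)] N_V'[OF ru(4)] pu ru p(2) r(2) by auto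
  have pr: "p1 \<noteq> r1" "p1 \<noteq> r2" "p2 \<noteq> r1" "p2 \<noteq> r2"
    using mem disj by blast+
  have "r1 \<in> N p1 \<or> r2 \<in> N p1" using meet[OF p r] .
  then obtain ra rb where ra: "ra \<in> N p1" and ab: "N v = {u, ra, rb}" "distinct [u, ra, rb]"
    and ab': "ra \<noteq> v" "rb \<noteq> v" "v \<in> N ra" "v \<in> N rb" "card (N ra) = 2" "card (N rb) = 2"
      "ra \<noteq> p1" "ra \<noteq> p2" "rb \<noteq> p1" "rb \<noteq> p2"
  proof
    assume "r1 \<in> N p1"
    then show thesis using that[of r1 r2] r ru c2(3,4) pr by auto
  next
    assume "r2 \<in> N p1"
    moreover have "N v = {u, r2, r1}" "distinct [u, r2, r1]" using r by auto
    ultimately show thesis using that[of r2 r1] ru c2(3,4) pr by auto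
  qed
  have Nra: "N ra = {p1, v}" using card_eq_2_pair[OF ab'(5) N_sym[OF ra] ab'(3)] mem uv p(2) by auto
  have "N u = {v, p2, p1}" "distinct [v, p2, p1]" using p by auto
  from meet[OF this ab(1,2)] have "ra \<in> N p2 \<or> rb \<in> N p2" .
  \<comment> \<open>\<open>ra\<close> already has its two neighbours \<open>p1\<close> and
    \<open>v\<close>, so \<open>p2\<close> must meet \<open>rb\<close>.\<close>
  then have rb: "rb \<in> N p2" using N_iff[of ra p2] p(2) ab'(8) by (auto simp: Nra)
  have Nrb: "N rb = {p2, v}" using card_eq_2_pair[OF ab'(6) N_sym[OF rb] ab'(4)] p(2) by auto
  have Np1: "N p1 = {u, ra}" using card_eq_2_pair[OF c2(1) pu(3) ra] ab(2) by auto
  have Np2: "N p2 = {u, rb}" using card_eq_2_pair[OF c2(2) pu(4) rb] ab(2) by auto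
  have "V = {u, v, p1, ra, p2, rb}"
  proof (rule connected)
    show "{u, v, p1, ra, p2, rb} \<subseteq> V"
      using N_subset_V[of u] N_subset_V[of v] by (simp add: p(1) ab(1))
    show "(\<Union>x\<in>{u, v, p1, ra, p2, rb}. N x) \<subseteq> {u, v, p1, ra, p2, rb}"
        by (simp add: p(1) ab(1) Np1 Np2 Nra Nrb)
  qed simp
  moreover have "distinct [u, v, p1, ra, p2, rb]" using p(2) ab(2) ab' pu ne by auto
  moreover have "N u = {p1, v, p2}" "N v = {ra, u, rb}" using p ab by auto
  ultimately show ?thesis using Np1 Np2 Nra Nrb by blast
qed

text \<open>Neighbourhoods that meet without being equal lead to a pentagon or to
  \<open>no_common_neighbour\<close>. If they are disjoint, the surroundings of \<open>u\<close>
  alone are contradictory: its neighbours are pairwise nonadjacent, and their second neighbours are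
  either all distinct, as in \<open>no_spider\<close>, or two of them coincide, as in
  \<open>no_square_path\<close>.\<close>

lemma degree_3_nonadjacent:
  assumes "u \<noteq> v" and uv: "v \<notin> N u" and uV: "u \<in> V" and vV: "v \<in> V"
    and du: "card (N u) = 3" and dv: "card (N v) = 3"
    and rest: "\<forall>x\<in>V - {u, v}. card (N x) = 2"
  shows "\<exists>x y z. distinct [u, v, x, y, z] \<and> V = {u, v, x, y, z} \<and>
      N u = {x, y, z} \<and> N v = {x, y, z} \<and> N x = {u, v} \<and> N y = {u, v} \<and> N z = {u, v}"
proof -
  have two: "card (N x) = 2" if "x \<in> V" "x \<noteq> u" "x \<noteq> v" for x
    using rest that by blast
  have vu: "u \<notin> N v" using uv N_sym by blast
  have c2: "card (N p) = 2" if "p \<in> N u \<or> p \<in> N v" for p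
    using two[of p] that N_V N_irrefl vu uv by blast
  have common: "N x = {u, v}" if "x \<in> N u" "x \<in> N v" for x
    using card_eq_2_pair[of "N x" u v] c2[of x] that N_sym assms(1) by blast
  have ex: "\<exists>s. N p = {u, s} \<and> s \<noteq> u" if "p \<in> N u" for p
    using card_eq_2_other[of "N p" u] c2[of p] that N_sym[OF that] by metis
  have finN: "finite (N u)" "finite (N v)" using du dv by (auto intro: card_ge_0_finite)
  show ?thesis
  proof (cases "N u = N v")
    case True
    have "N u \<noteq> {}" using du by auto
    then obtain x where "x \<in> N u" by blast
    then obtain y z where N: "N u = {x, y, z}" "distinct [x, y, z]" using card_eq_3_others[OF du] by blast
    then have "u \<notin> {x, y, z}" "v \<notin> {x, y, z}" using N_irrefl True by blast+
    moreover have N3: "N x = {u, v}" "N y = {u, v}" "N z = {u, v}" using N True by (auto intro!: common)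
    moreover have "V = {u, v, x, y, z}"
    proof (rule connected)
      show "{u, v, x, y, z} \<subseteq> V" using N_subset_V[of u] uV vV by (simp add: N(1))
      show "(\<Union>x\<in>{u, v, x, y, z}. N x) \<subseteq> {u, v, x, y, z}"
        by (simp add: N(1) N3 True[symmetric])
    qed simp
    moreover have "N v = {x, y, z}" using N True by simp
    moreover have "distinct [u, v, x, y, z]" using calculation(1,2) N(2) assms(1) by auto
    ultimately show ?thesis using N(1) by blast
  next
    case ne: False
    have False
    proof (cases "N u \<inter> N v = {}")
      case False
      then obtain x where x: "x \<in> N u" "x \<in> N v" by blast
      \<comment> \<open>Both sets have three elements, so an inclusion would be an equality.\<close>
      have "\<not> N u \<subseteq> N v" "\<not> N v \<subseteq> N u"
        using ne card_subset_eq[OF finN(2), of "N u"] card_subset_eq[OF finN(1), of "N v"] du dv by metis+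
      then obtain p r where pr: "p \<in> N u" "p \<notin> N v" "r \<in> N v" "r \<notin> N u" by blast
      obtain s where s: "N p = {u, s}" "s \<noteq> u" using ex[OF pr(1)] by blast
      have ne': "p \<noteq> v" "r \<noteq> u" "p \<noteq> u" "r \<noteq> v" "x \<noteq> p" "x \<noteq> r" "x \<noteq> u" "x \<noteq> v"
        using pr uv vu x N_irrefl by blast+
      show False
      proof (cases "r \<in> N p")
        case True
        have "distinct [u, p, r, v, x]" using pr True N_irrefl ne' assms(1) by auto
        moreover have "v \<notin> N p" "x \<notin> N p" "x \<notin> N r" using common[OF x] N_iff[of x] N_sym pr ne' by blast+
        ultimately show False
          using no_pentagon[of u p r v x] pr True uv x N_sym by blast
      next
        case False
        show False
          using no_common_neighbour[OF assms(1) common[OF x] s ne'(1) pr(2-4) ne'(2) False] .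
      qed
    next
      case disj: True
      have nadj: "p' \<notin> N p" if p: "p \<in> N u" "p' \<in> N u" for p p'
      proof
        assume a: "p' \<in> N p"
        then have "p \<noteq> p'" "u \<noteq> p" "u \<noteq> p'" using N_irrefl p by blast+
        then have N: "N p = {u, p'}" "N p' = {u, p}"
          using card_eq_2_pair[of "N p" u p'] card_eq_2_pair[of "N p'" u p] c2 p a N_sym by blast+
        obtain p3 where 3: "N u = {p, p', p3}" "distinct [p, p', p3]"
          using card_eq_3_other[OF du p \<open>p \<noteq> p'\<close>] .
        then obtain s where "N p3 = {u, s}" "s \<noteq> u" using ex[of p3] by auto
        with no_triangle_at_degree_3[OF 3(2,1) N] show False by blast
      qed
      \<comment> \<open>Disjointness of the two neighbourhoods keeps \<open>s\<close> different from
        \<open>v\<close>, which is why it has degree 2.\<close>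
      have outer: "p \<in> N s" "s \<notin> N u" "card (N s) = 2" if "p \<in> N u" "N p = {u, s}" "s \<noteq> u" for p s
      proof -
        have sp: "s \<in> N p" using that by simp
        then show "p \<in> N s" by (rule N_sym)
        show "s \<notin> N u" using nadj[OF that(1)] sp by blast
        have "s \<noteq> v" using N_sym[OF sp] that(1) disj by blast
        then show "card (N s) = 2" using two[of s] N_V[OF sp] that by blast
      qed
      have square: False
        if N: "N u = {p, p', p''}" "distinct [p, p', p'']" "N p = {u, s}" "N p' = {u, s}" "N p'' = {u, t}"
          and st: "s \<noteq> u" "t \<noteq> u" for p p' p'' s t
      proof -
        have m: "p \<in> N u" "p' \<in> N u" "p'' \<in> N u" using N by auto
        note os = outer[OF m(1) N(3) st(1)] outer[OF m(2) N(4) st(1)] and ot = outer[OF m(3) N(5) st(2)]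
        have Ns: "N s = {p, p'}" using card_eq_2_pair[OF os(3,1,4)] N(2) by auto
        then have "s \<noteq> t" using ot N(2) by auto
        obtain w where "N t = {p'', w}" "p'' \<noteq> w" using card_eq_2_other[OF ot(3,1)] .
        with no_square_path[OF N(2,1,3-5) Ns _ \<open>s \<noteq> t\<close> st(1) os(2) st(2) ot(2)] show False by blast
      qed
      have "N u \<noteq> {}" using du by auto
      then obtain p1 where "p1 \<in> N u" by blast
      then obtain p2 p3 where p: "N u = {p1, p2, p3}" "distinct [p1, p2, p3]"
        using card_eq_3_others[OF du] by blast
      then have m: "p1 \<in> N u" "p2 \<in> N u" "p3 \<in> N u" by auto
      obtain s1 s2 s3 where s: "N p1 = {u, s1}" "N p2 = {u, s2}" "N p3 = {u, s3}"
        "s1 \<noteq> u" "s2 \<noteq> u" "s3 \<noteq> u" using ex m by meson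
      have c: "N u = {p1, p3, p2}" "N u = {p2, p3, p1}" using p by auto
      have "s1 \<noteq> s2" using square[OF p s(1) _ s(3,4,6)] s(2) by blast
      moreover have "s1 \<noteq> s3" using square[OF c(1) _ s(1) _ s(2,4,5)] s(3) p(2) by auto
      moreover have "s2 \<noteq> s3" using square[OF c(2) _ s(2) _ s(1,5,4)] s(3) p(2) by auto
      ultimately have "distinct [s1, s2, s3]" by simp
      from no_spider[OF p(2,1) s(1-3) this s(4) _ s(5) _ s(6)] outer(2) m s show False by blast
    qed
    then show ?thesis ..
  qed
qed

text \<open>The excesses of the degrees over 2 sum to 2. Natural subtraction is harmless here, as no
  degree is below 2.\<close>

lemma degree_cases:
  obtains v where "v \<in> V" "card (N v) = 4" "\<forall>x\<in>V - {v}. card (N x) = 2"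
  | u v where "u \<in> V" "v \<in> V" "u \<noteq> v" "card (N u) = 3" "card (N v) = 3"
      "\<forall>x\<in>V - {u, v}. card (N x) = 2"
proof -
  have ge: "card (N x) = (card (N x) - 2) + 2" if "x \<in> V" for x
    using degree_ge_2[OF that] by linarith
  have "(\<Sum>x\<in>V. card (N x)) = (\<Sum>x\<in>V. (card (N x) - 2) + 2)"
    by (rule sum.cong[OF refl ge])
  then have "(\<Sum>x\<in>V. card (N x) - 2) = 2"
    unfolding degree_sum sum.distrib sum_constant of_nat_id by simp
  from sum_eq_2_cases[OF finite_V this] show thesis
  proof cases
    case (1 a)
    have "card (N x) = 2" if "x \<in> V - {a}" for x
      using 1(3)[of x] ge[of x] that by simp
    then show thesis using that(1)[of a] ge[of a] 1(1,2) by simp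
  next
    case (2 a b)
    have "card (N x) = 2" if "x \<in> V - {a, b}" for x
      using 2(6)[of x] ge[of x] that by simp
    then show thesis using that(2)[of a b] ge[of a] ge[of b] 2(1-5) by simp
  qed
qed

end

section \<open>Application to weighted graphs\<close>

definition nbrs :: "'a wgraph \<Rightarrow> 'a \<Rightarrow> 'a set" where
  "nbrs G x = {y. {x, y} \<in> edges G}"

lemma nbrs_sym: "y \<in> nbrs G x \<Longrightarrow> x \<in> nbrs G y"
  by (simp add: nbrs_def insert_commute)

lemma nbrs_irrefl: "weighted_graph G \<Longrightarrow> x \<notin> nbrs G x"
  by (auto simp: nbrs_def weighted_graph_def)

lemma nbrs_verts: "weighted_graph G \<Longrightarrow> y \<in> nbrs G x \<Longrightarrow> y \<in> verts G"
  by (auto simp: nbrs_def weighted_graph_def)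

lemma edge_doubleton:
  assumes "weighted_graph G" "e \<in> edges G"
  obtains s t where "e = {s, t}" "s \<noteq> t" "s \<in> verts G" "t \<in> verts G"
proof -
  have "card e = 2" "e \<subseteq> verts G" using assms by (auto simp: weighted_graph_def)
  then show thesis using that by (auto simp: card_2_iff)
qed

text \<open>Turns the neighbourhoods found by the classification back into an explicit edge
  set.\<close>

lemma edges_eq_nbrs:
  assumes "weighted_graph G"
  shows "edges G = (\<Union>s\<in>verts G. (\<lambda>t. {s, t}) ` nbrs G s)"
proof (intro equalityI subsetI)
  fix e assume e: "e \<in> edges G"
  then obtain s t where st: "e = {s, t}" "s \<in> verts G" using edge_doubleton[OF assms e] by metis
  then have "t \<in> nbrs G s" using e by (simp add: nbrs_def)
  then show "e \<in> (\<Union>s\<in>verts G. (\<lambda>t. {s, t}) ` nbrs G s)" using st by blast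
qed (auto simp: nbrs_def)

lemma finite_edges: "weighted_graph G \<Longrightarrow> finite (edges G)"
  by (rule finite_subset[of _ "Pow (verts G)"]) (auto simp: weighted_graph_def)

lemma vertex_degree_eq_card_nbrs:
  assumes "weighted_graph G"
  shows "vertex_degree G x = card (nbrs G x)"
proof -
  have "bij_betw (\<lambda>y. {x, y}) (nbrs G x) {e \<in> edges G. x \<in> e}"
    unfolding bij_betw_def
  proof
    show "inj_on (\<lambda>y. {x, y}) (nbrs G x)" by (auto simp: inj_on_def doubleton_eq_iff)
    show "(\<lambda>y. {x, y}) ` nbrs G x = {e \<in> edges G. x \<in> e}"
    proof (intro equalityI subsetI)
      fix e assume e: "e \<in> {e \<in> edges G. x \<in> e}"
      then have "e \<in> edges G" by simp
      then obtain s t where st: "e = {s, t}" by (rule edge_doubleton[OF assms])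
      then obtain y where "e = {x, y}" using e by auto
      then show "e \<in> (\<lambda>y. {x, y}) ` nbrs G x" using e by (auto simp: nbrs_def)
    qed (auto simp: nbrs_def)
  qed
  then show ?thesis by (simp add: vertex_degree_def bij_betw_same_card)
qed

lemma sum_card_nbrs:
  assumes "weighted_graph G"
  shows "(\<Sum>x\<in>verts G. card (nbrs G x)) = 2 * card (edges G)"
proof -
  have fin: "finite (verts G)" "finite (edges G)"
    using assms finite_edges by (auto simp: weighted_graph_def)
  have "(\<Sum>x\<in>verts G. card (nbrs G x)) = (\<Sum>x\<in>verts G. \<Sum>e\<in>{e \<in> edges G. x \<in> e}. 1::nat)"
    by (simp add: vertex_degree_eq_card_nbrs[OF assms, symmetric] vertex_degree_def)
  also have "\<dots> = (\<Sum>e\<in>edges G. \<Sum>x\<in>{x \<in> verts G. x \<in> e}. 1)"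
    using fin by (rule sum.swap_restrict)
  also have "\<dots> = (\<Sum>e\<in>edges G. 2)"
  proof (rule sum.cong)
    fix e assume "e \<in> edges G"
    then have "card e = 2" "{x \<in> verts G. x \<in> e} = e" using assms by (auto simp: weighted_graph_def)
    then show "(\<Sum>x\<in>{x \<in> verts G. x \<in> e}. 1::nat) = 2" by simp
  qed simp
  finally show ?thesis by simp
qed

lemma connected_graph_closed:
  assumes "connected_graph G" "S \<subseteq> verts G" "S \<noteq> {}" and closed: "(\<Union>x\<in>S. nbrs G x) \<subseteq> S"
  shows "verts G = S"
proof -
  obtain s where s: "s \<in> S" using assms(3) by blast
  have "t \<in> S" if "t \<in> verts G" for t
  proof -
    have "(s, t) \<in> {(s, t). {s, t} \<in> edges G}\<^sup>*"
      using assms s that unfolding connected_graph_def by blast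
    then show ?thesis
    proof induction
      case base
      show ?case by (rule s)
    next
      case (step y z)
      then have "z \<in> nbrs G y" by (simp add: nbrs_def)
      then show ?case using step closed by blast
    qed
  qed
  then show ?thesis using assms(2) by blast
qed

text \<open>Without negative entries the sum has only nonnegative terms, so each term vanishes, and
  positive weights pass this on to the entries. A change of sign handles the case without positive
  entries.\<close>

lemma null_row_sign:
  fixes w x :: "'a \<Rightarrow> real"
  assumes "finite S" "\<And>k. k \<in> S \<Longrightarrow> w k > 0" "(\<Sum>k\<in>S. w k * x k) = 0"
  shows "(\<forall>y\<in>S. x y = 0) \<or> (\<exists>y\<in>S. x y > 0) \<and> (\<exists>y\<in>S. x y < 0)"
proof -
  have zero: "\<forall>k\<in>S. v k = 0" if sgn: "\<forall>k\<in>S. v k \<ge> 0" and "(\<Sum>k\<in>S. w k * v k) = 0" for v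
  proof -
    have "\<forall>k\<in>S. w k * v k \<ge> 0" using sgn assms(2) by (simp add: less_imp_le)
    then have "\<forall>k\<in>S. w k * v k = 0"
      using sum_nonneg_eq_0_iff[OF assms(1), of "\<lambda>k. w k * v k"] that(2) by simp
    then show ?thesis using assms(2) by (metis less_irrefl mult_eq_0_iff)
  qed
  show ?thesis
  proof (cases "(\<exists>y\<in>S. x y > 0) \<and> (\<exists>y\<in>S. x y < 0)")
    case True
    then show ?thesis by (rule disjI2)
  next
    case False
    then consider "\<forall>y\<in>S. x y \<le> 0" | "\<forall>y\<in>S. x y \<ge> 0" by (meson not_le)
    then have "\<forall>y\<in>S. x y = 0"
    proof cases
      case 1
      then have "\<forall>k\<in>S. - x k = 0" using zero[of "\<lambda>k. - x k"] assms(3) by (simp add: sum_negf)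
      then show ?thesis by simp
    next
      case 2
      then show ?thesis using zero[of x] assms(3) by simp
    qed
    then show ?thesis by (rule disjI1)
  qed
qed

lemma rank_four_bicyclic_graphI:
  assumes G: "weighted_graph G" and bi: "bicyclic G" and np: "\<not> (\<exists>x. pendant G x)"
    and vs: "distinct vs" "set vs = verts G" and rank: "matrix_rank (adjacency_matrix G vs) = 4"
  shows "rank_four_bicyclic_graph (verts G) (nbrs G)"
proof
  fix x y assume "y \<in> nbrs G x"
  then show "x \<in> nbrs G y" by (rule nbrs_sym)
next
  fix x show "x \<notin> nbrs G x" by (rule nbrs_irrefl[OF G])
next
  fix x y assume "y \<in> nbrs G x"
  then show "y \<in> verts G" by (rule nbrs_verts[OF G])
next
  fix a b c d e
  assume dist: "distinct [a, b, c, d, e]" and sub: "{a, b, c, d, e} \<subseteq> verts G"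
  let ?K = "{a, b, c, d, e}"
  have "matrix_rank (adjacency_matrix G vs) < card ?K" using dist rank by simp
  from adjacency_rank_less_imp_null_vector[OF vs sub this] obtain x
    where nz: "\<exists>k\<in>?K. x k \<noteq> 0" and null: "\<forall>z\<in>verts G. (\<Sum>k\<in>?K. adj G z k * x k) = 0"
    by (elim exE conjE)
  have row: "(\<forall>y\<in>nbrs G z \<inter> ?K. x y = 0) \<or>
      (\<exists>y\<in>nbrs G z \<inter> ?K. x y > 0) \<and> (\<exists>y\<in>nbrs G z \<inter> ?K. x y < 0)" for z
  proof (cases "z \<in> verts G")
    case True
    have "(\<Sum>k\<in>nbrs G z \<inter> ?K. adj G z k * x k) = (\<Sum>k\<in>?K. adj G z k * x k)"
      by (rule sum.mono_neutral_left) (auto simp: nbrs_def adj_def)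
    then have "(\<Sum>k\<in>nbrs G z \<inter> ?K. adj G z k * x k) = 0" using null True by simp
    moreover have "adj G z k > 0" if "k \<in> nbrs G z \<inter> ?K" for k
      using that adj_pos[OF G, of z k] by (simp add: nbrs_def)
    ultimately show ?thesis by (intro null_row_sign[of _ "adj G z"]) simp_all
  next
    case False
    \<comment> \<open>A vertex outside the graph has no neighbours, so the row condition holds for
      every \<open>z\<close>.\<close>
    then have "nbrs G z = {}" using nbrs_verts[OF G] nbrs_sym by (metis ex_in_conv)
    then show ?thesis by simp
  qed
  have "x a \<noteq> 0 \<or> x b \<noteq> 0 \<or> x c \<noteq> 0 \<or> x d \<noteq> 0 \<or> x e \<noteq> 0" using nz by simp
  then show "\<exists>x::'a \<Rightarrow> real. (x a \<noteq> 0 \<or> x b \<noteq> 0 \<or> x c \<noteq> 0 \<or> x d \<noteq> 0 \<or> x e \<noteq> 0) \<and>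
        (\<forall>z. (\<forall>y\<in>nbrs G z \<inter> ?K. x y = 0) \<or>
          (\<exists>y\<in>nbrs G z \<inter> ?K. x y > 0) \<and> (\<exists>y\<in>nbrs G z \<inter> ?K. x y < 0))"
    using row by (intro exI[of _ x] conjI allI)
next
  show "finite (verts G)" using G by (simp add: weighted_graph_def)
next
  fix S assume "S \<subseteq> verts G" "S \<noteq> {}" "(\<Union>x\<in>S. nbrs G x) \<subseteq> S"
  then show "verts G = S" using bi connected_graph_closed unfolding bicyclic_def by blast
next
  fix x assume x: "x \<in> verts G"
  have conn: "connected_graph G" and card: "card (edges G) = card (verts G) + 1"
    using bi by (simp_all add: bicyclic_def)
  have "card (nbrs G x) \<noteq> 1"
    using np x vertex_degree_eq_card_nbrs[OF G] by (auto simp: pendant_def)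
  \<comment> \<open>By connectedness an isolated vertex would be the whole graph, which then has no
    edge, contrary to the edge count.\<close>
  moreover have "card (nbrs G x) \<noteq> 0"
  proof
    assume "card (nbrs G x) = 0"
    moreover have "nbrs G x \<subseteq> verts G" using nbrs_verts[OF G] by blast
    moreover have "finite (verts G)" using G by (simp add: weighted_graph_def)
    ultimately have "card (nbrs G x) = 0" "finite (nbrs G x)" using finite_subset by blast+
    then have "nbrs G x = {}" by simp
    then have V: "verts G = {x}" using connected_graph_closed[OF conn, of "{x}"] x by simp
    have "edges G = {}"
    proof (rule ccontr)
      assume "edges G \<noteq> {}"
      then obtain e where "e \<in> edges G" by blast
      then show False using V by (auto elim!: edge_doubleton[OF G])
    qed
    then show False using card by simp
  qed
  ultimately show "2 \<le> card (nbrs G x)" by linarith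
next
  show "(\<Sum>x\<in>verts G. card (nbrs G x)) = 2 * card (verts G) + 2"
    using sum_card_nbrs[OF G] bi by (simp add: bicyclic_def)
qed

theorem theorem5p3:
  fixes G :: "'a wgraph" and vs :: "'a list"
  assumes "weighted_graph G" and "bicyclic G" and "\<not> (\<exists>x. pendant G x)"
    and "distinct vs" and "set vs = verts G"
  shows "matrix_rank (adjacency_matrix G vs) = 4 \<longleftrightarrow>
      (\<exists>a b. wgraph_iso G (infinity414 a b) \<and> a 1 * a 3 = a 2 * a 4 \<and> b 1 * b 3 = b 2 * b 4)
    \<or> (\<exists>a b c. wgraph_iso G (theta 1 1 1 a b c) \<and> (a 2 * b 1 \<noteq> a 1 * b 2 \<or> a 2 * c 1 \<noteq> a 1 * c 2))
    \<or> (\<exists>a b c. wgraph_iso G (theta 1 0 1 a b c) \<and> a 2 * c 1 \<noteq> a 1 * c 2)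
    \<or> (\<exists>a b c. wgraph_iso G (theta 1 0 2 a b c) \<and> b 1 * c 2 = c 1 * c 3)
    \<or> (\<exists>a b c. wgraph_iso G (theta 2 0 2 a b c) \<and>
          a 2 * b 1 * c 2 - a 1 * a 3 * c 2 - a 2 * c 1 * c 3 = 0)"
    (is "?L \<longleftrightarrow> ?inf \<or> ?t111 \<or> ?t101 \<or> ?t102 \<or> ?t202")
proof
  note G = assms(1) and vs = assms(4,5)
  assume rank: ?L
  interpret rank_four_bicyclic_graph "verts G" "nbrs G"
    by (rule rank_four_bicyclic_graphI[OF assms rank])
  \<comment> \<open>Every case ends alike: the neighbourhoods determine the edge set, and the rank
    equivalence of the shape converts rank 4 into its weight condition.\<close>
  note E = edges_eq_nbrs[OF G]
  show "?inf \<or> ?t111 \<or> ?t101 \<or> ?t102 \<or> ?t202"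
  proof (cases rule: degree_cases)
    case (1 v)
    from degree_4_vertex[OF 1(2,3)] obtain p1 p2 p3 p4 q r where d: "distinct [v, p1, p2, p3, p4, q, r]"
      and V: "verts G = {v, p1, p2, p3, p4, q, r}"
      and N: "nbrs G v = {p1, p2, p3, p4}" "nbrs G p1 = {v, q}" "nbrs G p2 = {v, q}" "nbrs G p3 = {v, r}"
        "nbrs G p4 = {v, r}" "nbrs G q = {p1, p2}" "nbrs G r = {p3, p4}"
      by (elim exE conjE)
    \<comment> \<open>The shape lists its vertices along the two cycles, so \<open>q\<close> stands
      between \<open>p1\<close> and \<open>p2\<close>, and \<open>r\<close> between
      \<open>p3\<close> and \<open>p4\<close>.\<close>
    have d': "distinct [v, p1, q, p2, p3, r, p4]" using d by auto
    have V': "verts G = {v, p1, q, p2, p3, r, p4}" unfolding V by (intro equalityI) simp_all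
    have E': "edges G = {{v, p1}, {p1, q}, {q, p2}, {p2, v}, {v, p3}, {p3, r}, {r, p4}, {p4, v}}"
      unfolding E V by (intro equalityI) (simp_all add: N doubleton_eq_iff)
    have ?inf unfolding infinity414_iso_iff[OF G]
      using infinity414_rank[OF G vs d' V' E'] rank d' V' E' by blast
    then show ?thesis by (rule disjI1)
  next
    case (2 u v)
    show ?thesis
    proof (cases "v \<in> nbrs G u")
      case adj: True
      show ?thesis
      proof (cases "nbrs G u \<inter> nbrs G v = {}")
        case True
        from degree_3_adjacent_disjoint[OF adj 2(4-6) True] obtain x1 x2 z1 z2
          where d: "distinct [u, v, x1, x2, z1, z2]" and V: "verts G = {u, v, x1, x2, z1, z2}"
          and N: "nbrs G u = {x1, v, z1}" "nbrs G v = {x2, u, z2}" "nbrs G x1 = {u, x2}" "nbrs G x2 = {x1, v}"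
            "nbrs G z1 = {u, z2}" "nbrs G z2 = {z1, v}"
          by (elim exE conjE)
        have E': "edges G = {{u, x1}, {x1, x2}, {x2, v}, {u, v}, {u, z1}, {z1, z2}, {z2, v}}"
          unfolding E V by (intro equalityI) (simp_all add: N doubleton_eq_iff)
        have ?t202 unfolding theta_202_iso_iff[OF G]
          using theta_202_rank[OF G vs d V E'] rank d V E' by blast
        then show ?thesis by blast
      next
        case False
        then obtain x where x: "x \<in> nbrs G u" "x \<in> nbrs G v" by blast
        from degree_3_adjacent_common[OF adj 2(4-6) x] show ?thesis
        proof (elim disjE exE conjE)
          fix z assume d: "distinct [u, v, x, z]" and V: "verts G = {u, v, x, z}"
            and N: "nbrs G u = {x, v, z}" "nbrs G v = {x, u, z}" "nbrs G x = {u, v}" "nbrs G z = {u, v}"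
          have E': "edges G = {{u, x}, {x, v}, {u, v}, {u, z}, {z, v}}"
            unfolding E V by (intro equalityI) (simp_all add: N doubleton_eq_iff)
          have ?t101 unfolding theta_101_iso_iff[OF G]
            using theta_101_rank[OF G vs d V E'] rank d V E' by blast
          then show ?thesis by blast
        next
          fix z1 z2 assume d: "distinct [u, v, x, z1, z2]" and V: "verts G = {u, v, x, z1, z2}"
            and N: "nbrs G u = {x, v, z1}" "nbrs G v = {x, u, z2}" "nbrs G x = {u, v}"
              "nbrs G z1 = {u, z2}" "nbrs G z2 = {z1, v}"
          have E': "edges G = {{u, x}, {x, v}, {u, v}, {u, z1}, {z1, z2}, {z2, v}}"
            unfolding E V by (intro equalityI) (simp_all add: N doubleton_eq_iff)
          have ?t102 unfolding theta_102_iso_iff[OF G]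
            using theta_102_rank[OF G vs d V E'] rank d V E' by blast
          then show ?thesis by blast
        qed
      qed
    next
      case False
      from degree_3_nonadjacent[OF 2(3) False 2(1,2,4-6)] obtain x y z
        where d: "distinct [u, v, x, y, z]" and V: "verts G = {u, v, x, y, z}"
        and N: "nbrs G u = {x, y, z}" "nbrs G v = {x, y, z}" "nbrs G x = {u, v}" "nbrs G y = {u, v}" "nbrs G z = {u, v}"
        by (elim exE conjE)
      have E': "edges G = {{u, x}, {x, v}, {u, y}, {y, v}, {u, z}, {z, v}}"
        unfolding E V by (intro equalityI) (simp_all add: N doubleton_eq_iff)
      have ?t111 unfolding theta_111_iso_iff[OF G]
        using theta_111_rank[OF G vs d V E'] rank d V E' by blast
      then show ?thesis by blast
    qed
  qed
next
  note G = assms(1) and vs = assms(4,5)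
  assume "?inf \<or> ?t111 \<or> ?t101 \<or> ?t102 \<or> ?t202"
  then show ?L
  proof (elim disjE)
    assume ?inf
    then show ?L unfolding infinity414_iso_iff[OF G]
      by (elim exE conjE) (simp only: infinity414_rank[OF G vs] simp_thms)
  next
    assume ?t111
    then show ?L unfolding theta_111_iso_iff[OF G]
      by (elim exE conjE) (simp only: theta_111_rank[OF G vs] simp_thms)
  next
    assume ?t101
    then show ?L unfolding theta_101_iso_iff[OF G]
      by (elim exE conjE) (simp only: theta_101_rank[OF G vs] simp_thms)
  next
    assume ?t102
    then show ?L unfolding theta_102_iso_iff[OF G]
      by (elim exE conjE) (simp only: theta_102_rank[OF G vs] simp_thms)
  next
    assume ?t202
    then show ?L unfolding theta_202_iso_iff[OF G]
      by (elim exE conjE) (simp only: theta_202_rank[OF G vs] simp_thms)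
  qed
qed

end
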